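(* Let $s\geq 3$ be an integer. Then there exist constants $c_1,c_2>0$, depending only on $s$, such that for every sufficiently large $n$ the threshold bias of the diameter game $\mathcal{D}_{s,n}$ satisfies $$c_1 n^{1-1/\lceil s/2\rceil}\leq b_{\mathcal{D}_{s,n}}\leq c_2 n^{1-1/\lceil s/2\rceil}.$$
   Context: A $(1:b)$ Maker-Breaker game on a finite board $X$ with a family of winning sets: Maker and Breaker alternately claim unclaimed elements of $X$, Maker $1$ per round and Breaker $b$ per round, until all are claimed; Maker wins if she claims all elements of some winning set, otherwise Breaker wins. The threshold bias is the unique integer $b_0$ such that Breaker wins the $(1:b)$ game iff $b\geq b_0$. The diameter game $\mathcal{D}_{s,n}$ is the Maker-Breaker game played on the edge set of $K_n$ in which Maker wins iff her graph at the end of the game is a spanning subgraph of $K_n$ of diameter at most $s$, i.e., every two vertices are joined by a path of Maker's edges of length at most $s$. *)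

theory Defs
  imports Complex_Main
begin

text \<open>Positions: the set M of elements claimed by Maker, the set B of elements
claimed by Breaker, and a flag telling whether it is Maker's turn (True) or
Breaker's turn (False).  mwin X F b t M B holds iff Maker has a strategy that
wins from this position (the game is finite, so the least fixed point is exactly
the set of positions from which Maker can force a win).  Maker claims one free
element per round, Breaker claims b free elements (or all remaining ones if
fewer than b are left).  Maker wins iff at the end (no free elements) she has
claimed all elements of some winning set.\<close>

inductive mwin :: "'a set \<Rightarrow> 'a set set \<Rightarrow> nat \<Rightarrow> bool \<Rightarrow> 'a set \<Rightarrow> 'a set \<Rightarrow> bool"
  for X :: "'a set" and F :: "'a set set" and b :: nat where
  game_over: "X - M - B = {} \<Longrightarrow> W \<in> F \<Longrightarrow> W \<subseteq> M \<Longrightarrow> mwin X F b t M B"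
| maker_move: "e \<in> X - M - B \<Longrightarrow> mwin X F b False (insert e M) B \<Longrightarrow> mwin X F b True M B"
| breaker_move: "X - M - B \<noteq> {} \<Longrightarrow>
     (\<forall>S. S \<subseteq> X - M - B \<and> card S = min b (card (X - M - B)) \<longrightarrow> mwin X F b True M (B \<union> S))
     \<Longrightarrow> mwin X F b False M B"

definition maker_wins :: "'a set \<Rightarrow> 'a set set \<Rightarrow> nat \<Rightarrow> bool" where
  "maker_wins X F b \<longleftrightarrow> mwin X F b True {} {}"

definition breaker_wins :: "'a set \<Rightarrow> 'a set set \<Rightarrow> nat \<Rightarrow> bool" where
  "breaker_wins X F b \<longleftrightarrow> \<not> maker_wins X F b"

text \<open>Threshold bias: the (unique) b0 such that Breaker wins iff b \<ge> b0; taken as the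
least b for which Breaker wins.\<close>
definition threshold_bias :: "'a set \<Rightarrow> 'a set set \<Rightarrow> nat" where
  "threshold_bias X F = (LEAST b. breaker_wins X F b)"

definition Kn_edges :: "nat \<Rightarrow> nat set set" where
  "Kn_edges n = {{u, v} | u v. u < n \<and> v < n \<and> u \<noteq> v}"

text \<open>There is a path (equivalently a walk) of length at most k from u to v
using edges of E.\<close>
definition path_within :: "nat set set \<Rightarrow> nat \<Rightarrow> nat \<Rightarrow> nat \<Rightarrow> bool" where
  "path_within E k u v \<longleftrightarrow> (\<exists>ps. ps \<noteq> [] \<and> hd ps = u \<and> last ps = v \<and> length ps \<le> k + 1 \<and>
      (\<forall>i < length ps - 1. {ps ! i, ps ! (i + 1)} \<in> E))"

definition diam_winning_sets :: "nat \<Rightarrow> nat \<Rightarrow> nat set set set" where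
  "diam_winning_sets s n = {G. G \<subseteq> Kn_edges n \<and>
      (\<forall>u < n. \<forall>v < n. u \<noteq> v \<longrightarrow> path_within G s u v)}"

definition diameter_threshold :: "nat \<Rightarrow> nat \<Rightarrow> nat" where
  "diameter_threshold s n = threshold_bias (Kn_edges n) (diam_winning_sets s n)"

end

theory Submission
  imports Defs "HOL-Real_Asymp.Real_Asymp"
begin

text \<open>Write \<open>k = \<lceil>s / 2\<rceil>\<close>, so that \<open>2 k - 1 \<le> s \<le> 2 k\<close>.

  Breaker with bias \<open>C n powr (1 - 1 / k)\<close> keeps two vertices \<open>u\<close>, \<open>v\<close> at distance more than \<open>2 k\<close>.  As
  long as few vertices are touched, he answers each edge by claiming all edges between its
  endpoints and the touched vertices, so that the components of \<open>u\<close> and \<open>v\<close> grow by pendant edges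
  only, and uses the other half of his bias to close the balls around \<open>u\<close> and \<open>v\<close> level by level.
  When the balls of radius \<open>k - 2\<close> are closed, those of radius \<open>k - 1\<close> are fixed and smaller than a
  fraction of the bias, and he only has to separate each newly touched vertex from them.

  Against bias \<open>c n powr (1 - 1 / k)\<close> Maker gets diameter \<open>2 k - 1\<close>.  She has to hit a finite family of
  boxes, sets of edges that may change with the history, and plays an edge of maximal total danger
  for the potential that charges a box both for Breaker's claims in it and for its mere size in
  every round.  Hence a box that is never hit contains few claims of Breaker, and large boxes are
  hit early, when few edges are claimed at all.  The balls around all vertices grow by a factor \<open>D\<close>
  of order \<open>n powr (1 / k)\<close> per level; to avoid a logarithmic loss in the union bound, growth is measured in
  residue classes modulo \<open>D ^ j\<close>, with one box for each set of classes to be met.  A ball of radius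
  \<open>k - 1\<close> exceeds the bias by a large constant factor.  So Breaker cannot cut off from it the vertices
  that join the ball of another vertex later, and Maker connects the two balls by one more edge.\<close>

section \<open>A potential strategy for boxes that depend on the history\<close>

type_synonym 'a hist = "('a \<times> 'a set) list"

definition Mset :: "'a hist \<Rightarrow> 'a set" where
  "Mset h = fst ` set h"

definition Bset :: "'a hist \<Rightarrow> 'a set" where
  "Bset h = \<Union> (snd ` set h)"

lemma Mset_simps [simp]: "Mset [] = {}" "Mset ((e, C) # h) = insert e (Mset h)"
  by (auto simp: Mset_def)

lemma Bset_simps [simp]: "Bset [] = {}" "Bset ((e, C) # h) = Bset h \<union> C"
  by (auto simp: Bset_def)

text \<open>A history lists the rounds played, latest first.  Breaker may claim fewer than \<open>b\<close>
  elements in a round, so that one strategy serves all smaller biases.\<close>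

inductive legal :: "'a set \<Rightarrow> nat \<Rightarrow> ('a hist \<Rightarrow> 'a) \<Rightarrow> 'a hist \<Rightarrow> bool"
  for X b \<sigma> where
  "legal X b \<sigma> []"
| "legal X b \<sigma> h \<Longrightarrow> X - Mset h - Bset h \<noteq> {} \<Longrightarrow> e = \<sigma> h \<Longrightarrow> e \<in> X - Mset h - Bset h \<Longrightarrow>
    C \<subseteq> X - Mset h - Bset h - {e} \<Longrightarrow> card C \<le> b \<Longrightarrow> legal X b \<sigma> ((e, C) # h)"

text \<open>\<open>legal\<close> bounds Breaker's claims per round only from above, so every play
  with bias \<open>b' \<le> b\<close> against \<open>\<sigma>\<close> is a legal history. The
  induction runs over the number of free elements.\<close>

lemma maker_wins_by_strategy:
  assumes fin: "finite X"
    and strat: "\<And>h. X - Mset h - Bset h \<noteq> {} \<Longrightarrow> \<sigma> h \<in> X - Mset h - Bset h"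
    and final: "\<And>h. legal X b \<sigma> h \<Longrightarrow> X - Mset h - Bset h = {} \<Longrightarrow> \<exists>W\<in>F. W \<subseteq> Mset h"
    and le: "b' \<le> b"
  shows "maker_wins X F b'"
proof -
  have main: "legal X b \<sigma> h \<Longrightarrow> mwin X F b' True (Mset h) (Bset h)" for h
  proof (induction "card (X - Mset h - Bset h)" arbitrary: h rule: less_induct)
    case less
    show ?case
    proof (cases "X - Mset h - Bset h = {}")
      case True
      with final[OF less.prems] show ?thesis by (meson mwin.game_over)
    next
      case False
      define e where "e = \<sigma> h"
      have e: "e \<in> X - Mset h - Bset h" using strat[OF False] by (simp add: e_def)
      have ext: "legal X b \<sigma> ((e, C) # h)"
        if "C \<subseteq> X - Mset h - Bset h - {e}" "card C \<le> b" for C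
        using legal.intros(2)[OF less.prems False e_def e that] .
      have IH: "mwin X F b' True (insert e (Mset h)) (Bset h \<union> C)"
        if "C \<subseteq> X - Mset h - Bset h - {e}" "card C \<le> b" for C
      proof -
        have "card (X - Mset ((e, C) # h) - Bset ((e, C) # h)) < card (X - Mset h - Bset h)"
          using e fin by (intro psubset_card_mono) auto
        from less.hyps[OF this ext[OF that]] show ?thesis by simp
      qed
      have "mwin X F b' False (insert e (Mset h)) (Bset h)"
      proof (cases "X - insert e (Mset h) - Bset h = {}")
        case True
        \<comment> \<open>Maker took the last element; an empty answer completes the round to a
          legal history.\<close>
        have "\<exists>W\<in>F. W \<subseteq> Mset ((e, {}) # h)"
          using True by (intro final ext) auto
        with True show ?thesis by (auto intro: mwin.game_over)
      next
        case False
        show ?thesis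
        proof (intro mwin.breaker_move[OF False] allI impI)
          fix C assume C: "C \<subseteq> X - insert e (Mset h) - Bset h \<and>
            card C = min b' (card (X - insert e (Mset h) - Bset h))"
          show "mwin X F b' True (insert e (Mset h)) (Bset h \<union> C)"
            by (rule IH) (use C le in auto)
        qed
      qed
      with e show ?thesis by (rule mwin.maker_move)
    qed
  qed
  from main[OF legal.intros(1)] show ?thesis by (simp add: maker_wins_def)
qed

text \<open>The index set is fixed while the content \<open>A h i\<close> varies with the history.
  \<open>exp (- l i)\<close> is the initial weight of box \<open>i\<close>, so
  \<open>weights\<close> is a union bound and \<open>l i\<close> the price paid for this
  box.\<close>

locale dynamic_boxes =
  fixes X :: "'a set" and b :: nat and I :: "'i set"
    and A :: "'a hist \<Rightarrow> 'i \<Rightarrow> 'a set" and l :: "'i \<Rightarrow> real"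
  assumes finite_X: "finite X" and b_pos: "b > 0" and finite_I: "finite I"
    and A_free: "\<And>h i. A h i \<subseteq> X - Mset h - Bset h"
    and weights: "(\<Sum>i\<in>I. exp (- l i)) \<le> 1"
begin

section \<open>The potential of the boxes\<close>

primrec alive :: "'a hist \<Rightarrow> 'i \<Rightarrow> bool" where
  "alive [] i = True"
| "alive (r # h) i = (alive h i \<and> fst r \<notin> A h i)"

text \<open>The load: each claim of Breaker is judged by the content of the box in that
  round.\<close>

primrec ld :: "'a hist \<Rightarrow> 'i \<Rightarrow> nat" where
  "ld [] i = 0"
| "ld (r # h) i = ld h i + card (snd r \<inter> A h i)"

text \<open>The pressure: a large box that stays unhit pays in every round, even if Breaker ignores
  it.\<close>

primrec pr :: "'a hist \<Rightarrow> 'i \<Rightarrow> nat" where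
  "pr [] i = 0"
| "pr (r # h) i = pr h i + card (A h i)"

text \<open>One round adds at most \<open>1 / 4\<close> to either fraction, which keeps the
  increment within the range of \<open>exp_le_linear\<close>.\<close>

definition pot :: "'a hist \<Rightarrow> 'i \<Rightarrow> real" where
  "pot h i = (if alive h i
    then exp (real (ld h i) / (4 * real b) + real (pr h i) / (4 * real (card X)) - l i) else 0)"

definition danger :: "'a hist \<Rightarrow> 'a \<Rightarrow> real" where
  "danger h x = (\<Sum>i\<in>I. if x \<in> A h i then pot h i else 0)"

definition strat :: "'a hist \<Rightarrow> 'a" where
  "strat h = (SOME x. x \<in> X - Mset h - Bset h \<and>
     (\<forall>y\<in>X - Mset h - Bset h. danger h y \<le> danger h x))"

lemma strat:
  assumes "X - Mset h - Bset h \<noteq> {}"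
  shows "strat h \<in> X - Mset h - Bset h"
    and "y \<in> X - Mset h - Bset h \<Longrightarrow> danger h y \<le> danger h (strat h)"
proof -
  let ?Y = "X - Mset h - Bset h"
  have fin: "finite ?Y" using finite_X by auto
  have "\<exists>x. x \<in> ?Y \<and> (\<forall>y\<in>?Y. danger h y \<le> danger h x)"
  proof -
    have "Max (danger h ` ?Y) \<in> danger h ` ?Y"
      using fin assms by (intro Max_in) auto
    then obtain x where "x \<in> ?Y" "Max (danger h ` ?Y) = danger h x" by auto
    moreover have "\<forall>y\<in>?Y. danger h y \<le> Max (danger h ` ?Y)" using fin by auto
    ultimately show ?thesis by auto
  qed
  from someI_ex[OF this]
  show "strat h \<in> ?Y" "y \<in> ?Y \<Longrightarrow> danger h y \<le> danger h (strat h)"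
    unfolding strat_def by auto
qed

lemma pot_nonneg: "pot h i \<ge> 0" by (simp add: pot_def)

lemma exp_le_linear: "0 \<le> x \<Longrightarrow> x \<le> 1/2 \<Longrightarrow> exp x \<le> 1 + 2 * (x::real)"
proof -
  assume x: "0 \<le> x" "x \<le> 1/2"
  have "exp x \<le> 1 + x + x\<^sup>2" using x by (intro exp_bound) auto
  also have "x\<^sup>2 \<le> x * 1" unfolding power2_eq_square using x by (intro mult_left_mono) auto
  finally show ?thesis by simp
qed

lemma sum_danger:
  assumes "finite C"
  shows "(\<Sum>x\<in>C. danger h x) = (\<Sum>i\<in>I. pot h i * real (card (C \<inter> A h i)))"
proof -
  have "(\<Sum>x\<in>C. danger h x) = (\<Sum>i\<in>I. \<Sum>x\<in>C. if x \<in> A h i then pot h i else 0)"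
    unfolding danger_def by (rule sum.swap)
  also have "\<dots> = (\<Sum>i\<in>I. pot h i * real (card (C \<inter> A h i)))"
    using assms by (intro sum.cong refl) (simp add: sum.If_cases Int_def)
  finally show ?thesis .
qed

text \<open>Between two turns of Maker an alive box gains at most the factor
  \<open>1 + (Breaker's claims in it) / 2b + (its size) / 2N\<close>.  Since Maker took an element of maximal
  danger, the first surplus amounts in total to at most half of what she removed, and so does
  the second, being half an average of dangers.\<close>

lemma pot_decrease:
  assumes "legal X b strat (r # h)"
  shows "(\<Sum>i\<in>I. pot (r # h) i) \<le> (\<Sum>i\<in>I. pot h i)"
proof -
  obtain e C where r: "r = (e, C)" by force
  let ?Y = "X - Mset h - Bset h"
  have ne: "?Y \<noteq> {}" and e: "e = strat h" and eY: "e \<in> ?Y" and C: "C \<subseteq> ?Y - {e}" and cC: "card C \<le> b"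
    using assms unfolding r by (auto elim: legal.cases)
  have finC: "finite C" using C finite_X finite_subset by blast
  have finY: "finite ?Y" using finite_X by auto
  define N where "N = real (card X)"
  have N: "N > 0" using ne finite_X by (auto simp: N_def card_gt_0_iff)
  have B: "real b > 0" using b_pos by simp
  have finA: "finite (A h i)" for i using A_free finite_X by (meson finite_Diff finite_subset)
  have step: "pot (r # h) i \<le> (pot h i - (if e \<in> A h i then pot h i else 0))
      + pot h i * (real (card (C \<inter> A h i)) / (2 * b) + real (card (A h i)) / (2 * N))" for i
  proof (cases "alive h i \<and> e \<notin> A h i")
    case True
    define x where "x = real (card (C \<inter> A h i)) / (4 * b) + real (card (A h i)) / (4 * N)"
    have c1: "real (card (C \<inter> A h i)) \<le> real b"
      using cC card_mono[OF finC, of "C \<inter> A h i"] by (simp add: le_trans)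
    have c2: "real (card (A h i)) \<le> N"
      unfolding N_def using finite_X A_free[of h i] by (auto intro!: card_mono)
    have x0: "x \<ge> 0" unfolding x_def using N B by (auto intro!: add_nonneg_nonneg)
    have "real (card (C \<inter> A h i)) / (4 * b) \<le> 1/4" using c1 B by (simp add: field_simps)
    moreover have "real (card (A h i)) / (4 * N) \<le> 1/4" using c2 N by (simp add: field_simps)
    ultimately have x1: "x \<le> 1/2" unfolding x_def by simp
    have "pot (r # h) i = pot h i * exp x"
      using True unfolding pot_def r x_def N_def
      by (simp add: exp_add[symmetric] add_divide_distrib algebra_simps)
    also have "\<dots> \<le> pot h i * (1 + 2 * x)"
      using exp_le_linear[OF x0 x1] pot_nonneg by (intro mult_left_mono) auto
    also have "\<dots> = pot h i + pot h i * (real (card (C \<inter> A h i)) / (2 * b) + real (card (A h i)) / (2 * N))"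
      using N B by (simp add: x_def field_simps)
    finally show ?thesis using True by simp
  next
    case False
    then have "pot (r # h) i = 0" by (auto simp: pot_def r)
    moreover have "0 \<le> pot h i * (real (card (C \<inter> A h i)) / (2 * b) + real (card (A h i)) / (2 * N))"
      using N B pot_nonneg[of h i] by (intro mult_nonneg_nonneg) auto
    ultimately show ?thesis using pot_nonneg[of h i] by auto
  qed
  have d: "danger h y \<le> danger h e" if "y \<in> ?Y" for y using strat(2)[OF ne that] e by simp
  have d0: "danger h e \<ge> 0" unfolding danger_def using pot_nonneg by (auto intro!: sum_nonneg)
  have "(\<Sum>x\<in>C. danger h x) \<le> real (card C) * danger h e"
    using C d by (intro sum_bounded_above) auto
  also have "\<dots> \<le> real b * danger h e" using cC d0 by (intro mult_right_mono) auto
  finally have s1: "(\<Sum>i\<in>I. pot h i * real (card (C \<inter> A h i))) \<le> real b * danger h e"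
    using sum_danger[OF finC] by simp
  have "(\<Sum>x\<in>?Y. danger h x) \<le> real (card ?Y) * danger h e"
    using d by (intro sum_bounded_above) auto
  also have "\<dots> \<le> N * danger h e" unfolding N_def
    using finite_X d0 by (intro mult_right_mono) (auto intro!: card_mono)
  finally have s2: "(\<Sum>i\<in>I. pot h i * real (card (A h i))) \<le> N * danger h e"
    using sum_danger[OF finY, of h] A_free[of h] by (simp add: Int_absorb1)
  have "(\<Sum>i\<in>I. pot (r # h) i) \<le> (\<Sum>i\<in>I. (pot h i - (if e \<in> A h i then pot h i else 0))
      + pot h i * (real (card (C \<inter> A h i)) / (2 * b) + real (card (A h i)) / (2 * N)))"
    by (rule sum_mono) (rule step)
  also have "\<dots> = (\<Sum>i\<in>I. pot h i) - danger h e
      + ((\<Sum>i\<in>I. pot h i * real (card (C \<inter> A h i))) / (2 * b)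
      + (\<Sum>i\<in>I. pot h i * real (card (A h i))) / (2 * N))"
    unfolding danger_def
    by (simp add: sum.distrib sum_subtractf sum_divide_distrib distrib_left)
  also have "\<dots> \<le> (\<Sum>i\<in>I. pot h i) - danger h e + (real b * danger h e / (2 * b) + N * danger h e / (2 * N))"
    using s1 s2 N B by (intro add_left_mono add_mono divide_right_mono) auto
  also have "\<dots> = (\<Sum>i\<in>I. pot h i)" using N B by (simp add: field_simps)
  finally show ?thesis .
qed

lemma sum_pot_le_1: "legal X b strat h \<Longrightarrow> (\<Sum>i\<in>I. pot h i) \<le> 1"
proof (induction h)
  case Nil
  then show ?case using weights by (simp add: pot_def)
next
  case (Cons r h)
  then have "legal X b strat h" by (auto elim: legal.cases)
  with Cons pot_decrease[OF Cons.prems] show ?case by simp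
qed

text \<open>A single potential is at most the total, which never exceeds its initial bound 1; take
  logarithms. Both terms are nonnegative, so the corollaries bound load and pressure
  separately.\<close>

theorem alive_bound:
  assumes "legal X b strat h" "i \<in> I" "alive h i"
  shows "real (ld h i) / (4 * real b) + real (pr h i) / (4 * real (card X)) \<le> l i"
proof -
  have "pot h i \<le> (\<Sum>i\<in>I. pot h i)"
    using assms finite_I pot_nonneg by (intro member_le_sum) auto
  also have "\<dots> \<le> 1" by (rule sum_pot_le_1) fact
  finally show ?thesis using assms by (simp add: pot_def)
qed

corollary ld_bound:
  assumes "legal X b strat h" "i \<in> I" "alive h i"
  shows "real (ld h i) \<le> 4 * real b * l i"
proof -
  have "real (ld h i) / (4 * real b) \<le> l i"
    using alive_bound[OF assms] by (smt (verit) divide_nonneg_nonneg of_nat_0_le_iff)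
  then show ?thesis using b_pos by (simp add: field_simps)
qed

corollary pr_bound:
  assumes "legal X b strat h" "i \<in> I" "alive h i" "X \<noteq> {}"
  shows "real (pr h i) \<le> 4 * real (card X) * l i"
proof -
  have "real (pr h i) / (4 * real (card X)) \<le> l i"
    using alive_bound[OF assms(1-3)] by (smt (verit) divide_nonneg_nonneg of_nat_0_le_iff)
  moreover have "card X > 0" using assms finite_X by (simp add: card_gt_0_iff)
  ultimately show ?thesis by (simp add: field_simps)
qed

end

section \<open>Maker's strategy\<close>

definition pairs :: "nat set \<Rightarrow> nat set \<Rightarrow> nat set set" where
  "pairs P Q = {{y, z} | y z. y \<in> P \<and> z \<in> Q}"

lemma pairsI: "y \<in> P \<Longrightarrow> z \<in> Q \<Longrightarrow> {y, z} \<in> pairs P Q"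
  by (auto simp: pairs_def)

lemma pairsE: "x \<in> pairs P Q \<Longrightarrow> (\<And>y z. x = {y, z} \<Longrightarrow> y \<in> P \<Longrightarrow> z \<in> Q \<Longrightarrow> R) \<Longrightarrow> R"
  by (auto simp: pairs_def)

lemma edge_in_Kn: "{y, z} \<in> Kn_edges n \<longleftrightarrow> y < n \<and> z < n \<and> y \<noteq> z"
  by (auto simp: Kn_edges_def doubleton_eq_iff)

lemma Kn_edges_alt: "Kn_edges n = {e. e \<subseteq> {..<n} \<and> card e = 2}"
  by (auto simp: Kn_edges_def card_2_iff)

lemma finite_Kn_edges: "finite (Kn_edges n)"
  unfolding Kn_edges_alt by (rule finite_subset[of _ "Pow {..<n}"]) auto

lemma card_Kn_edges: "2 * card (Kn_edges n) = n * (n - 1)"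
proof -
  have "card (Kn_edges n) = n choose 2"
    unfolding Kn_edges_alt using n_subsets[of "{..<n}" 2] by simp
  moreover have "even (n * (n - 1))" by (cases n) auto
  ultimately show ?thesis by (simp add: choose_two)
qed

lemma card_doubleton_le: "card {x, y} \<le> 2"
  by (cases "x = y") auto

text \<open>The map from ordered pairs to edges has fibres of size at most two.\<close>

lemma card_pairs_le:
  assumes "finite E" "\<And>y z. (y, z) \<in> R \<Longrightarrow> {y, z :: nat} \<in> E"
  shows "card R \<le> 2 * card E"
proof -
  have fib: "card {p. {fst p, snd p} = e} \<le> 2 \<and> finite {p. {fst p, snd p} = e}" for e :: "nat set"
  proof (cases "\<exists>a c. e = {a, c}")
    case True
    then obtain a c where e: "e = {a, c}" by blast
    have sub: "{p. {fst p, snd p} = e} \<subseteq> {(a, c), (c, a)}"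
    proof
      fix p assume "p \<in> {p. {fst p, snd p} = e}"
      then show "p \<in> {(a, c), (c, a)}" unfolding e by (cases p) (simp add: doubleton_eq_iff)
    qed
    have "card {(a, c), (c, a)} \<le> 2" by (rule card_doubleton_le)
    with card_mono[OF _ sub] finite_subset[OF sub] show ?thesis by (meson finite.intros order.trans)
  next
    case False
    then have "{p. {fst p, snd p} = e} = {}" by blast
    then show ?thesis by (metis card.empty finite.emptyI zero_le)
  qed
  have sub: "R \<subseteq> (\<Union>e\<in>E. {p. {fst p, snd p} = e})"
  proof
    fix p assume "p \<in> R"
    then have "{fst p, snd p} \<in> E" by (intro assms(2)) simp
    then show "p \<in> (\<Union>e\<in>E. {p. {fst p, snd p} = e})" by blast
  qed
  have "card R \<le> card (\<Union>e\<in>E. {p. {fst p, snd p} = e})"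
    using assms(1) fib by (intro card_mono sub finite_UN_I) blast+
  also have "\<dots> \<le> (\<Sum>e\<in>E. card {p. {fst p, snd p} = e})"
    by (rule card_UN_le) fact
  also have "\<dots> \<le> of_nat (card E) * 2" using fib by (intro sum_bounded_above) blast
  finally show ?thesis by simp
qed
text \<open>A box \<open>Lev v u j Q\<close> makes the ball of \<open>v\<close> grow from level \<open>j\<close> into a residue class in \<open>Q\<close>
  through vertices that are good for \<open>u\<close>; \<open>Bd u Z\<close> prevents the vertices of \<open>Z\<close> from all becoming
  bad for \<open>u\<close>; \<open>Pr u v\<close> joins the balls of \<open>u\<close> and \<open>v\<close>.\<close>

datatype box = Lev nat nat nat "nat set" | Bd nat "nat set" | Pr nat nat

text \<open>\<open>D\<close> is the growth factor per level, \<open>b\<close> Breaker's bias,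
  \<open>dl\<close> the number of claimed edges from which a vertex is no longer added to balls,
  \<open>q\<close> the loss in a core of about \<open>2 q\<close> vertices that makes a vertex bad,
  and \<open>lam\<close> the logarithmic part of the union bound.\<close>

locale maker_params =
  fixes n k D b q dl :: nat and lam :: real
begin

definition free :: "nat set hist \<Rightarrow> nat set set" where
  "free h = Kn_edges n - Mset h - Bset h"

definition deg :: "nat set hist \<Rightarrow> nat \<Rightarrow> nat" where
  "deg h x = card {y. y < n \<and> y \<noteq> x \<and> {x, y} \<notin> free h}"

text \<open>\<open>Ball h j v\<close> is a subset of the ball of radius \<open>j\<close>: a vertex is only added while few of its
  edges are claimed, and only through an edge claimed after its predecessor was added.  \<open>Core h u\<close>
  consists of the first \<open>2 q\<close> (or one more) vertices of \<open>Ball h (k - 1) u\<close>.  A vertex becomes bad for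
  \<open>u\<close>, and remains so, when Breaker owns \<open>q\<close> of its edges to the full core of \<open>u\<close> before Maker
  owns any.\<close>

definition High :: "nat set hist \<Rightarrow> nat set" where
  "High h = {x. x < n \<and> dl \<le> deg h x}"

primrec Ball :: "nat set hist \<Rightarrow> nat \<Rightarrow> nat \<Rightarrow> nat set" where
  "Ball [] j v = (if j = 0 then {v} else {})"
| "Ball (r # h) j v = Ball h j v \<union>
     (case j of 0 \<Rightarrow> {} | Suc i \<Rightarrow> {z. \<exists>w\<in>Ball h i v. fst r = {w, z} \<and> z \<notin> High h})"

primrec Core :: "nat set hist \<Rightarrow> nat \<Rightarrow> nat set" where
  "Core [] u = {}"
| "Core (r # h) u = Core h u \<union> (if 2 * q \<le> card (Core h u) then {} else
     {z. \<exists>w\<in>Ball h (k - 2) u. fst r = {w, z} \<and> z \<notin> High h})"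

definition full :: "nat set hist \<Rightarrow> nat \<Rightarrow> bool" where
  "full h u \<longleftrightarrow> 2 * q \<le> card (Core h u)"

definition bad :: "nat set hist \<Rightarrow> nat \<Rightarrow> nat \<Rightarrow> bool" where
  "bad h u z \<longleftrightarrow> full h u \<and> (\<forall>y\<in>Core h u. {y, z} \<notin> Mset h) \<and>
     q \<le> card {y \<in> Core h u. y \<noteq> z \<and> {y, z} \<notin> free h}"

primrec Bad :: "nat set hist \<Rightarrow> nat \<Rightarrow> nat set" where
  "Bad [] u = {}"
| "Bad (r # h) u = Bad h u \<union> {z. z < n \<and> bad (r # h) u z}"

text \<open>Membership is decided when a vertex joins level \<open>Suc j\<close> of
  \<open>v\<close>; it is not revoked if the vertex becomes bad later.\<close>

primrec Good :: "nat set hist \<Rightarrow> nat \<Rightarrow> nat \<Rightarrow> nat \<Rightarrow> nat set" where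
  "Good [] j v u = {}"
| "Good (r # h) j v u = Good h j v u \<union>
     {z. \<exists>w\<in>Ball h j v. fst r = {w, z} \<and> z \<notin> High h \<and> z \<notin> Bad h u}"

text \<open>Only vertices that join after the core of \<open>u\<close> is complete: they meet a
  fixed target set, of which they have lost little at that time.\<close>

primrec Late :: "nat set hist \<Rightarrow> nat \<Rightarrow> nat \<Rightarrow> nat set" where
  "Late [] v u = {}"
| "Late (r # h) v u = Late h v u \<union> (if full h u then
     {z. \<exists>w\<in>Ball h (k - 2) v. fst r = {w, z} \<and> z \<notin> High h \<and> z \<notin> Bad h u} else {})"

fun A :: "nat set hist \<Rightarrow> box \<Rightarrow> nat set set" where
  "A h (Lev v u j Q) = free h \<inter>
     pairs (Ball h j v) ({z. z < n \<and> z mod D ^ Suc j \<in> Q} - (High h \<union> Bad h u))"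
| "A h (Bd u Z) = free h \<inter> pairs (Core h u) (Z - Bad h u)"
| "A h (Pr u v) = free h \<inter> pairs (Late h v u) (Core h u)"

definition I :: "box set" where
  "I = (\<lambda>(v, u, j, Q). Lev v u j Q) ` ({..<n} \<times> {..<n} \<times> (SIGMA j:{..<k - 1}. Pow {..<D ^ Suc j}))
     \<union> (\<lambda>(u, Z). Bd u Z) ` ({..<n} \<times> Pow {..<n})
     \<union> (\<lambda>(u, v). Pr u v) ` ({..<n} \<times> {..<n})"

text \<open>The summand next to \<open>lam\<close> pays for the \<open>2 ^ m\<close> choices of
  \<open>Q\<close> or \<open>Z\<close>, as \<open>2 ^ m * exp (- m) \<le> 1\<close>;
  \<open>lam\<close> pays for the polynomially many other indices.\<close>

fun l :: "box \<Rightarrow> real" where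
  "l (Lev v u j Q) = lam + real (D ^ Suc j)"
| "l (Bd u Z) = lam + real n"
| "l (Pr u v) = lam"

lemma finite_I: "finite I"
  unfolding I_def by (intro finite_UnI finite_imageI finite_cartesian_product finite_SigmaI) auto

lemma A_free: "A h i \<subseteq> Kn_edges n - Mset h - Bset h"
  by (cases i) (auto simp: free_def)

lemma exp_pow2: "2 ^ m * exp (- real m) \<le> 1"
proof -
  have "(2::real) ^ m \<le> exp 1 ^ m" using exp_ge_add_one_self[of 1] by (intro power_mono) auto
  also have "\<dots> = exp (real m)" by (metis exp_of_nat_mult mult.right_neutral)
  finally show ?thesis by (simp add: exp_minus field_simps)
qed

lemma sum_weights:
  assumes "real (n ^ 2) * real (k + 1) \<le> exp lam" "k \<ge> 1"
  shows "(\<Sum>i\<in>I. exp (- l i)) \<le> 1"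
proof -
  have Un: "(\<Sum>i\<in>P \<union> Q. f i) \<le> (\<Sum>i\<in>P. f i) + (\<Sum>i\<in>Q. f i)"
    if "finite P" "finite Q" "\<And>i. f i \<ge> 0" for P Q :: "box set" and f :: "box \<Rightarrow> real"
    using sum.union_inter[OF that(1,2), of f] sum_nonneg[of "P \<inter> Q" f] that(3) by simp
  let ?I1 = "(\<lambda>(v, u, j, Q). Lev v u j Q) ` ({..<n} \<times> {..<n} \<times> (SIGMA j:{..<k - 1}. Pow {..<D ^ Suc j}))"
  let ?I2 = "(\<lambda>(u, Z). Bd u Z) ` ({..<n} \<times> Pow {..<n})"
  let ?I3 = "(\<lambda>(u, v). Pr u v) ` ({..<n} \<times> {..<n})"
  let ?e = "exp (- lam)"
  have Pow1: "(\<Sum>Q\<in>Pow {..<m}. exp (- (lam + real m))) \<le> ?e" for m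
  proof -
    have "(\<Sum>Q\<in>Pow {..<m}. exp (- (lam + real m))) = ?e * (2 ^ m * exp (- real m))"
      by (simp only: minus_add_distrib exp_add sum_constant card_Pow finite_lessThan
          card_lessThan of_nat_power of_nat_numeral mult_ac)
    also have "\<dots> \<le> ?e * 1" by (intro mult_left_mono exp_pow2) auto
    finally show ?thesis by simp
  qed
  have "(\<Sum>i\<in>?I1. exp (- l i)) = (\<Sum>(v, u, j, Q)\<in>{..<n} \<times> {..<n} \<times> (SIGMA j:{..<k - 1}. Pow {..<D ^ Suc j}). exp (- l (Lev v u j Q)))"
    by (subst sum.reindex) (auto simp: inj_on_def split_def simp del: power_Suc intro!: sum.cong)
  also have "\<dots> = (\<Sum>v<n. \<Sum>u<n. \<Sum>j<k - 1. \<Sum>Q\<in>Pow {..<D ^ Suc j}. exp (- l (Lev v u j Q)))"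
    by (simp add: sum.Sigma del: power_Suc l.simps)
  also have "\<dots> \<le> (\<Sum>v<n. \<Sum>u<n. \<Sum>j<k - 1. ?e)"
    by (intro sum_mono) (simp only: l.simps Pow1)
  finally have 1: "(\<Sum>i\<in>?I1. exp (- l i)) \<le> ?e * (real (n ^ 2) * (real k - 1))"
    using assms by (simp add: power2_eq_square of_nat_diff mult_ac)
  have "(\<Sum>i\<in>?I2. exp (- l i)) = (\<Sum>(u, Z)\<in>{..<n} \<times> Pow {..<n}. exp (- l (Bd u Z)))"
    by (subst sum.reindex) (auto simp: inj_on_def split_def simp del: l.simps sum_constant)
  also have "\<dots> = (\<Sum>u<n. \<Sum>Z\<in>Pow {..<n}. exp (- l (Bd u Z)))"
    by (subst sum.Sigma) (auto simp del: l.simps sum_constant)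
  also have "\<dots> \<le> (\<Sum>u<n. ?e)"
    by (intro sum_mono) (simp only: l.simps Pow1)
  also have "\<dots> = ?e * real n" by simp
  also have "real n \<le> real (n ^ 2)" unfolding of_nat_le_iff by (simp add: power2_eq_square)
  finally have 2: "(\<Sum>i\<in>?I2. exp (- l i)) \<le> ?e * real (n ^ 2)" by simp
  have 3: "(\<Sum>i\<in>?I3. exp (- l i)) = ?e * real (n ^ 2)"
    by (subst sum.reindex) (auto simp: inj_on_def split_def power2_eq_square)
  have "(\<Sum>i\<in>I. exp (- l i)) \<le> (\<Sum>i\<in>?I1 \<union> ?I2. exp (- l i)) + (\<Sum>i\<in>?I3. exp (- l i))"
    unfolding I_def by (intro Un finite_UnI finite_imageI finite_cartesian_product finite_SigmaI) auto
  also have "(\<Sum>i\<in>?I1 \<union> ?I2. exp (- l i)) \<le> (\<Sum>i\<in>?I1. exp (- l i)) + (\<Sum>i\<in>?I2. exp (- l i))"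
    by (intro Un finite_imageI finite_cartesian_product finite_SigmaI) auto
  \<comment> \<open>The factor \<open>k + 1\<close> consists of the \<open>k - 1\<close> levels of
    \<open>Lev\<close> and one share each for \<open>Bd\<close> and \<open>Pr\<close>.\<close>
  finally have "(\<Sum>i\<in>I. exp (- l i)) \<le> ?e * (real (n ^ 2) * real (k + 1))"
    using 1 2 3 by (simp add: algebra_simps)
  also have "\<dots> \<le> ?e * exp lam" using assms by (intro mult_left_mono) auto
  also have "\<dots> = 1" by (simp add: exp_minus)
  finally show ?thesis .
qed

end

text \<open>\<open>bD\<close> keeps the edges claimed in the first \<open>k * T\<close> rounds to a
  small fraction of all edges. \<open>bDk\<close> makes half of \<open>D ^ (k - 1)\<close> exceed
  the size of a core by more than \<open>lam\<close>.\<close>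

locale maker_game = maker_params +
  assumes k2: "k \<ge> 2" and b1: "b \<ge> 1" and D1: "D \<ge> 1"
    and lam: "real (n ^ 2) * real (k + 1) \<le> exp lam" "lam \<le> real D" "lam \<ge> 0"
    and Dk: "D ^ k \<le> n"
    and bD: "134217728 * k * b * D \<le> n"
    and q: "q = 1024 * b"
    and dl: "dl = n div 256"
    and bDk: "8192 * b + 4 * lam + 8 \<le> real (D ^ (k - 1))"
begin

sublocale dynamic_boxes "Kn_edges n" b I A l
  using finite_Kn_edges b1 finite_I A_free sum_weights lam k2
  by unfold_locales auto

abbreviation "play \<equiv> legal (Kn_edges n) b strat"

lemma playD:
  assumes "play ((e, C) # h)"
  shows "play h" "e \<in> free h" "C \<subseteq> free h" "card C \<le> b" "finite C" "e \<notin> C"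
proof -
  show "play h" "e \<in> free h" "C \<subseteq> free h" "card C \<le> b" "e \<notin> C"
    using assms by (auto elim: legal.cases simp: free_def)
  then show "finite C" unfolding free_def using finite_Kn_edges by (meson finite_subset finite_Diff)
qed

lemma play_tl: "play (r # h) \<Longrightarrow> play h"
  using playD(1) by (cases r) auto

lemma free_Cons: "free ((e, C) # h) = free h - insert e C"
  by (auto simp: free_def)

lemma free_mono: "free (r # h) \<subseteq> free h"
  by (cases r) (auto simp: free_Cons)

lemma free_edge: "{y, z} \<in> free h \<Longrightarrow> y < n \<and> z < n \<and> y \<noteq> z"
  by (auto simp: free_def edge_in_Kn)

lemma free_Nil: "{y, z} \<in> free [] \<longleftrightarrow> y < n \<and> z < n \<and> y \<noteq> z"
  by (auto simp: free_def edge_in_Kn)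

text \<open>Bounds the non-free pairs of a growing box: each pair was lost before its source vertex
  joined (at most \<open>p\<close> per source), or was claimed by Breaker inside the box.  Targets that become
  excluded count with the number \<open>t\<close> of pairs they had lost by then.\<close>

lemma counting:
  fixes Src Ex Tg :: "nat set hist \<Rightarrow> nat set"
  assumes ok: "ok h" and ok_step: "\<And>r h. ok (r # h) \<Longrightarrow> ok h"
    and okD: "\<And>h. ok h \<Longrightarrow> play h \<and> alive h i"
    and A: "\<And>h. ok h \<Longrightarrow> A h i = free h \<inter> pairs (Src h) (Tg h - Ex h)"
    and SrcV: "\<And>h. ok h \<Longrightarrow> Src h \<subseteq> {..<n}" and TgV: "\<And>h. ok h \<Longrightarrow> Tg h \<subseteq> {..<n}"
    and Src_mono: "\<And>r h. ok (r # h) \<Longrightarrow> Src h \<subseteq> Src (r # h)"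
    and Ex_mono: "\<And>r h. ok (r # h) \<Longrightarrow> Ex h \<subseteq> Ex (r # h)"
    and Ex_Nil: "Tg [] \<inter> Ex [] = {} \<or> t = 0"
    and Tg: "\<And>r h. ok (r # h) \<Longrightarrow> Tg (r # h) = Tg h \<or> (Src h = {} \<and> Ex (r # h) = {})"
    and join: "\<And>r h y. ok (r # h) \<Longrightarrow> y \<in> Src (r # h) - Src h \<Longrightarrow>
        card {z \<in> Tg (r # h). z \<noteq> y \<and> {y, z} \<notin> free (r # h)} \<le> p"
    and exc: "\<And>r h z. ok (r # h) \<Longrightarrow> z \<in> Tg (r # h) \<inter> (Ex (r # h) - Ex h) \<Longrightarrow>
        t \<le> card {y \<in> Src (r # h). y \<noteq> z \<and> {y, z} \<notin> free (r # h)}"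
  shows "card {(y, z). y \<in> Src h \<and> z \<in> Tg h - Ex h \<and> y \<noteq> z \<and> {y, z} \<notin> free h}
      + t * card (Tg h \<inter> Ex h) \<le> p * card (Src h) + 2 * ld h i"
  using ok
proof (induction h)
  case Nil
  have empty: "{(y, z). y \<in> Src [] \<and> z \<in> Tg [] - Ex [] \<and> y \<noteq> z \<and> {y, z} \<notin> free []} = {}"
    using SrcV[OF Nil] TgV[OF Nil] by (auto simp: free_Nil)
  show ?case unfolding empty using Ex_Nil by auto
next
  case (Cons r h)
  obtain e C where r: "r = (e, C)" by force
  let ?h = "r # h"
  have okh: "ok h" using ok_step[OF Cons.prems] .
  have "play ?h" "alive ?h i" using okD[OF Cons.prems] by auto
  then have eA: "e \<notin> A h i" and C: "finite C" "C \<subseteq> free h"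
    using playD unfolding r by auto
  define N where "N = (\<lambda>E g. {(y, z). y \<in> Src g \<and> z \<in> Tg g - E \<and> y \<noteq> z \<and> {y, z} \<notin> free g})"
  have IH: "card (N (Ex h) h) + t * card (Tg h \<inter> Ex h) \<le> p * card (Src h) + 2 * ld h i"
    using Cons.IH[OF okh] by (simp add: N_def)
  have finS: "finite (Src ?h)" "finite (Tg ?h)" "finite (Src h)" "finite (Tg h)"
    using SrcV TgV okh Cons.prems finite_subset[OF _ finite_lessThan[of n]] by auto
  have finN: "finite (N E g)" if "finite (Src g)" "finite (Tg g)" for E g
    by (rule finite_subset[of _ "Src g \<times> Tg g"]) (use that in \<open>auto simp: N_def\<close>)
  have new: "card {(y, z). y \<in> Src ?h - Src h \<and> z \<in> Tg ?h \<and> y \<noteq> z \<and> {y, z} \<notin> free ?h}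
      \<le> p * (card (Src ?h) - card (Src h))"
  proof -
    have "{(y, z). y \<in> Src ?h - Src h \<and> z \<in> Tg ?h \<and> y \<noteq> z \<and> {y, z} \<notin> free ?h}
      = (SIGMA y:Src ?h - Src h. {z \<in> Tg ?h. z \<noteq> y \<and> {y, z} \<notin> free ?h})" by auto
    then have "card {(y, z). y \<in> Src ?h - Src h \<and> z \<in> Tg ?h \<and> y \<noteq> z \<and> {y, z} \<notin> free ?h}
      = (\<Sum>y\<in>Src ?h - Src h. card {z \<in> Tg ?h. z \<noteq> y \<and> {y, z} \<notin> free ?h})"
      using finS by (simp add: card_SigmaI)
    also have "\<dots> \<le> of_nat (card (Src ?h - Src h)) * p"
      by (rule sum_bounded_above) (rule join[OF Cons.prems])
    also have "card (Src ?h - Src h) = card (Src ?h) - card (Src h)"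
      using finS Src_mono[OF Cons.prems] by (intro card_Diff_subset) auto
    finally show ?thesis by (simp add: mult.commute)
  qed
  have pS: "p * card (Src h) + p * (card (Src ?h) - card (Src h)) = p * card (Src ?h)"
  proof -
    have "card (Src h) \<le> card (Src ?h)" using finS Src_mono[OF Cons.prems] by (intro card_mono) auto
    then show ?thesis by (simp add: distrib_left[symmetric])
  qed
  \<comment> \<open>A target that becomes excluded takes at least \<open>t\<close> lost pairs out of
    the count; the sets \<open>R z\<close> of these pairs are disjoint for different
    targets.\<close>
  have excl: "card (N (Ex ?h) ?h) + t * card (Tg ?h \<inter> (Ex ?h - Ex h)) \<le> card (N (Ex h) ?h)"
  proof -
    define E where "E = Tg ?h \<inter> (Ex ?h - Ex h)"
    define R where "R = (\<lambda>z. {y \<in> Src ?h. y \<noteq> z \<and> {y, z} \<notin> free ?h} \<times> {z})"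
    have finE: "finite E" using finS by (simp add: E_def)
    have finR: "finite (R z)" for z using finS by (simp add: R_def)
    have "t * card E \<le> (\<Sum>z\<in>E. card {y \<in> Src ?h. y \<noteq> z \<and> {y, z} \<notin> free ?h})"
      using sum_bounded_below[of E t "\<lambda>z. card {y \<in> Src ?h. y \<noteq> z \<and> {y, z} \<notin> free ?h}"]
        exc[OF Cons.prems] by (simp add: E_def mult.commute)
    also have "\<dots> = (\<Sum>z\<in>E. card (R z))" by (simp add: R_def card_cartesian_product)
    also have "\<dots> = card (\<Union>z\<in>E. R z)"
      using finE finR by (intro card_UN_disjoint[symmetric]) (auto simp: R_def)
    finally have "card (N (Ex ?h) ?h) + t * card E \<le> card (N (Ex ?h) ?h) + card (\<Union>z\<in>E. R z)" by simp
    also have "\<dots> = card (N (Ex ?h) ?h \<union> (\<Union>z\<in>E. R z))"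
      using finN[OF finS(1,2)] finE finR
      by (intro card_Un_disjoint[symmetric]) (auto simp: N_def R_def E_def)
    also have "\<dots> \<le> card (N (Ex h) ?h)"
      using finN[OF finS(1,2)] Ex_mono[OF Cons.prems]
      by (intro card_mono) (auto simp: N_def R_def E_def)
    finally show ?thesis by (simp add: E_def)
  qed
  show ?case
  proof (cases "Tg ?h = Tg h")
    case True
    have sub: "N (Ex h) ?h \<subseteq> N (Ex h) h
        \<union> {(y, z). y \<in> Src ?h - Src h \<and> z \<in> Tg ?h \<and> y \<noteq> z \<and> {y, z} \<notin> free ?h}
        \<union> {(y, z). y \<in> Src h \<and> z \<in> Tg h - Ex h \<and> {y, z} \<in> free h - free ?h}"
      using True by (auto simp: N_def)
    have fin3: "finite {(y, z). y \<in> Src h \<and> z \<in> Tg h - Ex h \<and> {y, z} \<in> free h - free ?h}"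
      by (rule finite_subset[of _ "Src h \<times> Tg h"]) (use finS in auto)
    have fin2: "finite {(y, z). y \<in> Src ?h - Src h \<and> z \<in> Tg ?h \<and> y \<noteq> z \<and> {y, z} \<notin> free ?h}"
      by (rule finite_subset[of _ "Src ?h \<times> Tg ?h"]) (use finS in auto)
    \<comment> \<open>A pair lost in this round at an old source was in the box. Maker did not hit
      the box, so Breaker claimed the edge and the load counts it; the factor 2 is for the two
      orders of a pair.\<close>
    have "card {(y, z). y \<in> Src h \<and> z \<in> Tg h - Ex h \<and> {y, z} \<in> free h - free ?h} \<le> 2 * card (C \<inter> A h i)"
    proof (rule card_pairs_le)
      show "finite (C \<inter> A h i)" using C by auto
      fix y z assume "(y, z) \<in> {(y, z). y \<in> Src h \<and> z \<in> Tg h - Ex h \<and> {y, z} \<in> free h - free ?h}"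
      then have "{y, z} \<in> insert e C" "{y, z} \<in> A h i"
        using A[OF okh] by (auto simp: r free_Cons intro: pairsI)
      then show "{y, z} \<in> C \<inter> A h i" using eA by auto
    qed
    moreover have "card (N (Ex h) ?h) \<le> card (N (Ex h) h)
        + card {(y, z). y \<in> Src ?h - Src h \<and> z \<in> Tg ?h \<and> y \<noteq> z \<and> {y, z} \<notin> free ?h}
        + card {(y, z). y \<in> Src h \<and> z \<in> Tg h - Ex h \<and> {y, z} \<in> free h - free ?h}"
      using order.trans[OF card_mono[OF _ sub] order.trans[OF card_Un_le add_right_mono[OF card_Un_le]]]
        finN[OF finS(3,4)] fin2 fin3 by auto
    moreover have "card (Tg ?h \<inter> Ex ?h) = card (Tg h \<inter> Ex h) + card (Tg ?h \<inter> (Ex ?h - Ex h))"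
      using finS True Ex_mono[OF Cons.prems]
      by (subst card_Un_disjoint[symmetric]) (auto intro!: arg_cong[of _ _ card])
    ultimately show ?thesis using IH new excl pS
      by (simp add: N_def r distrib_left)
  next
    \<comment> \<open>The target set changes only while there is no source, so all counted pairs
      belong to new sources.\<close>
    case False
    with Tg[OF Cons.prems] have F: "Src h = {}" "Ex ?h = {}" by auto
    then have "N (Ex ?h) ?h = {(y, z). y \<in> Src ?h - Src h \<and> z \<in> Tg ?h \<and> y \<noteq> z \<and> {y, z} \<notin> free ?h}"
      by (auto simp: N_def)
    then show ?thesis using new F by (simp add: N_def)
  qed
qed

end

section \<open>Walks in Maker's graph\<close>

definition adj :: "nat set set \<Rightarrow> (nat \<times> nat) set" where
  "adj M = {(x, y). {x, y} \<in> M}"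

definition conn :: "nat set set \<Rightarrow> nat \<Rightarrow> nat \<Rightarrow> nat \<Rightarrow> bool" where
  "conn M j x y \<longleftrightarrow> (\<exists>i\<le>j. (x, y) \<in> adj M ^^ i)"

lemma path_within_iff_conn: "path_within M j x y \<longleftrightarrow> conn M j x y"
proof
  assume "path_within M j x y"
  then obtain ps where ps: "ps \<noteq> []" "hd ps = x" "last ps = y" "length ps \<le> j + 1"
    "\<forall>i < length ps - 1. {ps ! i, ps ! (i + 1)} \<in> M"
    unfolding path_within_def by auto
  have "(x, y) \<in> adj M ^^ (length ps - 1)"
    unfolding relpow_fun_conv
    by (rule exI[of _ "\<lambda>i. ps ! i"]) (use ps in \<open>auto simp: adj_def hd_conv_nth last_conv_nth\<close>)
  with ps(4) show "conn M j x y" unfolding conn_def by (intro exI[of _ "length ps - 1"]) auto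
next
  assume "conn M j x y"
  then obtain i f where i: "i \<le> j" and f: "f 0 = x" "f i = y" "\<forall>m<i. (f m, f (Suc m)) \<in> adj M"
    unfolding conn_def relpow_fun_conv by auto
  have "last (map f [0..<Suc i]) = y" using f by (simp add: last_map)
  moreover have "hd (map f [0..<Suc i]) = x" using f by (simp add: hd_map del: upt_Suc)
  ultimately show "path_within M j x y" unfolding path_within_def
    using f i by (intro exI[of _ "map f [0..<Suc i]"]) (auto simp: adj_def nth_append simp del: upt_Suc)
qed

lemma conn_refl [simp]: "conn M j x x"
  unfolding conn_def by (rule exI[of _ 0]) auto

lemma conn_mono: "conn M j x y \<Longrightarrow> M \<subseteq> M' \<Longrightarrow> j \<le> j' \<Longrightarrow> conn M' j' x y"
  unfolding conn_def relpow_fun_conv adj_def by (smt (verit) case_prodD case_prodI mem_Collect_eq order.trans subsetD)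

lemma conn_trans: "conn M i x y \<Longrightarrow> conn M j y z \<Longrightarrow> conn M (i + j) x z"
  unfolding conn_def using relpow_trans by (metis add_mono)

lemma conn_edge: "{x, y} \<in> M \<Longrightarrow> conn M (Suc 0) x y"
  unfolding conn_def by (rule exI[of _ "Suc 0"]) (auto simp: adj_def)

lemma conn_sym: "conn M j x y \<Longrightarrow> conn M j y x"
proof -
  have sym: "(x, y) \<in> adj M \<Longrightarrow> (y, x) \<in> adj M" for x y by (simp add: adj_def insert_commute)
  have "(x, y) \<in> adj M ^^ i \<Longrightarrow> (y, x) \<in> adj M ^^ i" for i
  proof (induction i arbitrary: y)
    case (Suc i)
    then obtain z where "(x, z) \<in> adj M ^^ i" "(z, y) \<in> adj M" by auto
    with Suc.IH sym show ?case by (blast intro: relpow_Suc_I2)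
  qed auto
  then show "conn M j x y \<Longrightarrow> conn M j y x" by (auto simp: conn_def)
qed

section \<open>Monotonicity and size of balls, cores and exceptional sets\<close>

context maker_game
begin

lemma play_edge: "play (r # h) \<Longrightarrow> fst r = {w, z} \<Longrightarrow> w < n \<and> z < n \<and> w \<noteq> z"
  using playD(2) free_edge by (metis prod.collapse)

lemma Ball_mono: "Ball h j v \<subseteq> Ball (r # h) j v" by auto

lemma Ball_0: "Ball h 0 v = {v}"
  by (induction h) auto

lemma Ball_lt: "play h \<Longrightarrow> v < n \<Longrightarrow> Ball h j v \<subseteq> {..<n}"
proof (induction h arbitrary: j)
  case (Cons r h)
  then have IH: "Ball h j v \<subseteq> {..<n}" using play_tl by blast
  have "z < n" if "fst r = {w, z}" for w z using play_edge[OF Cons.prems(1) that] by blast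
  with IH show ?case by (auto split: nat.splits)
qed auto

lemma Core_Ball: "Core h u \<subseteq> Ball h (k - 1) u"
proof (induction h)
  case (Cons r h)
  have "k - 1 = Suc (k - 2)" using k2 by simp
  with Cons show ?case by auto
qed auto

lemma Core_mono: "Core h u \<subseteq> Core (r # h) u" by auto

lemma Core_lt: "play h \<Longrightarrow> u < n \<Longrightarrow> Core h u \<subseteq> {..<n}"
  using Core_Ball Ball_lt by blast

lemma finite_Core: "play h \<Longrightarrow> u < n \<Longrightarrow> finite (Core h u)"
  using Core_lt finite_subset by blast

lemma full_mono: "play (r # h) \<Longrightarrow> u < n \<Longrightarrow> full h u \<Longrightarrow> full (r # h) u"
  unfolding full_def using card_mono[OF finite_Core Core_mono] order.trans by blast

lemma full_Core: "full h u \<Longrightarrow> Core (r # h) u = Core h u"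
  by (simp add: full_def)

lemma card_Core: "play h \<Longrightarrow> u < n \<Longrightarrow> card (Core h u) \<le> 2 * q + 1"
proof (induction h)
  case (Cons r h)
  then have pl: "play h" using play_tl by blast
  with Cons have IH: "card (Core h u) \<le> 2 * q + 1" by blast
  show ?case
  proof (cases "full h u")
    case True
    then show ?thesis using IH full_Core[OF True, of r] by argo
  next
    case False
    have "fst r \<in> free h" using playD(2) Cons.prems(1) by (metis prod.collapse)
    then obtain w z where wz: "fst r = {w, z}" unfolding free_def Kn_edges_def by blast
    \<comment> \<open>The edge of one round may add both of its ends, hence \<open>2 * q + 1\<close>
      instead of \<open>2 * q\<close>.\<close>
    have "Core (r # h) u \<subseteq> Core h u \<union> {w, z}" using wz by auto
    then have "card (Core (r # h) u) \<le> card (Core h u \<union> {w, z})"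
      using finite_Core[OF pl Cons.prems(2)] by (intro card_mono) auto
    also have "\<dots> \<le> card (Core h u) + card {w, z}" by (rule card_Un_le)
    also have "\<dots> \<le> card (Core h u) + 2" by (intro add_left_mono card_doubleton_le)
    finally show ?thesis using False by (simp add: full_def)
  qed
qed auto

lemma Bad_mono: "Bad h u \<subseteq> Bad (r # h) u" by auto

lemma Bad_lt: "Bad h u \<subseteq> {..<n}" by (induction h) auto

lemma finite_Bad: "finite (Bad h u)" using Bad_lt finite_subset by blast

lemma Good_Ball: "Good h j v u \<subseteq> Ball h (Suc j) v"
  by (induction h) auto

lemma Late_Ball: "Late h v u \<subseteq> Ball h (k - 1) v"
proof (induction h)
  case (Cons r h)
  have "k - 1 = Suc (k - 2)" using k2 by simp
  with Cons show ?case by auto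
qed auto

lemma Late_full: "play h \<Longrightarrow> u < n \<Longrightarrow> Late h v u \<noteq> {} \<Longrightarrow> full h u"
proof (induction h)
  case (Cons r h)
  then show ?case using full_mono play_tl by (auto split: if_splits)
qed auto

lemma Ball_conn: "z \<in> Ball h j v \<Longrightarrow> conn (Mset h) j v z"
proof (induction h arbitrary: j z)
  case Nil
  then show ?case by (auto split: if_splits)
next
  case (Cons r h)
  have sub: "Mset h \<subseteq> Mset (r # h)" by (cases r) auto
  show ?case
  proof (cases "z \<in> Ball h j v")
    case True
    with Cons.IH conn_mono[OF _ sub] show ?thesis by blast
  next
    case False
    then obtain i w where j: "j = Suc i" and w: "w \<in> Ball h i v" "fst r = {w, z}"
      using Cons.prems by (auto split: nat.splits)
    have "conn (Mset (r # h)) i v w" using Cons.IH[OF w(1)] conn_mono[OF _ sub] by blast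
    moreover have "conn (Mset (r # h)) (Suc 0) w z" using w(2) by (intro conn_edge) (cases r; simp)
    ultimately show ?thesis using conn_trans by (fastforce simp: j)
  qed
qed

lemma finite_nonfree: "finite {y. y < n \<and> y \<noteq> x \<and> {x, y} \<notin> free h}" by simp

lemma High_mono: "High h \<subseteq> High (r # h)"
proof -
  have "deg h x \<le> deg (r # h) x" for x
    unfolding deg_def using free_mono[of r h] by (intro card_mono finite_nonfree) auto
  then show ?thesis unfolding High_def using order.trans by blast
qed

text \<open>A round claims at most \<open>b + 1\<close> edges, and distinct \<open>z\<close> give
  distinct edges at \<open>y\<close>.\<close>

lemma lost_le:
  assumes "play (r # h)" "T \<subseteq> {..<n}"
  shows "card {z \<in> T. z \<noteq> y \<and> {y, z} \<notin> free (r # h)} \<le> card {z \<in> T. z \<noteq> y \<and> {y, z} \<notin> free h} + (b + 1)"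
proof -
  obtain e C where r: "r = (e, C)" by force
  note p = playD[OF assms(1)[unfolded r]]
  have fin: "finite T" using assms(2) finite_subset by blast
  have "card {z \<in> T. z \<noteq> y \<and> {y, z} \<notin> free (r # h)}
      \<le> card ({z \<in> T. z \<noteq> y \<and> {y, z} \<notin> free h} \<union> {z \<in> T. {y, z} \<in> insert e C})"
    using fin by (intro card_mono) (auto simp: r free_Cons)
  also have "\<dots> \<le> card {z \<in> T. z \<noteq> y \<and> {y, z} \<notin> free h} + card {z \<in> T. {y, z} \<in> insert e C}"
    by (rule card_Un_le)
  also have "card {z \<in> T. {y, z} \<in> insert e C} \<le> card (insert e C)"
    by (rule card_inj_on_le[where f = "\<lambda>z. {y, z}"]) (use p in \<open>auto simp: inj_on_def doubleton_eq_iff\<close>)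
  also have "\<dots> = card C + 1" using p by simp
  finally show ?thesis using p(4) by simp
qed

text \<open>Fewer than \<open>dl\<close> edges at \<open>y\<close> were claimed before the round;
  the strict inequality absorbs Maker's own edge.\<close>

lemma join_le:
  assumes "play (r # h)" "T \<subseteq> {..<n}" "y \<notin> High h" "y < n"
  shows "card {z \<in> T. z \<noteq> y \<and> {y, z} \<notin> free (r # h)} \<le> dl + b"
proof -
  have "card {z \<in> T. z \<noteq> y \<and> {y, z} \<notin> free h} \<le> deg h y"
    unfolding deg_def using assms(2) by (intro card_mono finite_nonfree) auto
  moreover have "deg h y < dl" using assms by (auto simp: High_def)
  ultimately show ?thesis using lost_le[OF assms(1,2), of y] by linarith
qed

lemma card_claimed: "play h \<Longrightarrow> finite (Mset h \<union> Bset h) \<and> card (Mset h \<union> Bset h) \<le> (b + 1) * length h"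
proof (induction h)
  case (Cons r h)
  obtain e C where r: "r = (e, C)" by force
  note p = playD[OF Cons.prems[unfolded r]]
  have "Mset (r # h) \<union> Bset (r # h) = (Mset h \<union> Bset h) \<union> insert e C" by (auto simp: r)
  moreover have "card (insert e C) \<le> b + 1" using p by simp
  ultimately show ?case using Cons.IH[OF p(1)] p card_Un_le[of "Mset h \<union> Bset h" "insert e C"]
    by simp
qed auto

text \<open>Double counting: the numbers of claimed edges at the vertices sum to at most twice the
  number of claimed edges.\<close>

lemma card_High:
  assumes "play h"
  shows "dl * card (High h) \<le> 2 * ((b + 1) * length h)"
proof -
  have "dl * card (High h) \<le> (\<Sum>x\<in>High h. deg h x)"
    using sum_bounded_below[of "High h" dl "deg h"] by (simp add: High_def mult.commute)
  also have "\<dots> \<le> (\<Sum>x<n. deg h x)"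
    by (rule sum_mono2) (auto simp: High_def)
  also have "\<dots> = card (SIGMA x:{..<n}. {y. y < n \<and> y \<noteq> x \<and> {x, y} \<notin> free h})"
    by (simp add: deg_def card_SigmaI)
  also have "\<dots> \<le> 2 * card (Mset h \<union> Bset h)"
    by (rule card_pairs_le) (use card_claimed[OF assms] in \<open>auto simp: free_def edge_in_Kn\<close>)
  finally show ?thesis using card_claimed[OF assms] by linarith
qed

lemma n_big: "268435456 * b \<le> n" "268435456 * b * D \<le> n"
proof -
  have "2 * b * D \<le> k * b * D" using k2 by (intro mult_right_mono) auto
  then show *: "268435456 * b * D \<le> n" using bD by linarith
  have "b * 1 \<le> b * D" using D1 by (intro mult_left_mono) auto
  with * show "268435456 * b \<le> n" by linarith
qed

text \<open>A hit of the box gives a vertex of \<open>Z\<close> that is not yet bad an edge of Maker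
  to the core. As the core and Maker's graph only grow, \<open>bad\<close> fails for this vertex
  ever after.\<close>

lemma Bd_alive:
  assumes "play h" "\<not> alive h (Bd u Z)"
  shows "\<exists>z\<in>Z. z \<notin> Bad h u \<and> (\<exists>y\<in>Core h u. {y, z} \<in> Mset h)"
  using assms
proof (induction h rule: list.induct)
  case (Cons r h)
  have sub: "Mset h \<subseteq> Mset (r # h)" "fst r \<in> Mset (r # h)" by (cases r; auto)+
  have "\<exists>z\<in>Z. z \<notin> Bad h u \<and> (\<exists>y\<in>Core h u. {y, z} \<in> Mset (r # h))"
  proof (cases "alive h (Bd u Z)")
    case True
    then have "fst r \<in> A h (Bd u Z)" using Cons.prems(2) by simp
    then obtain y z where "fst r = {y, z}" "y \<in> Core h u" "z \<in> Z - Bad h u" by (auto elim!: pairsE)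
    with sub(2) show ?thesis by auto
  next
    case False
    with Cons.IH[OF play_tl[OF Cons.prems(1)]] sub(1) show ?thesis by blast
  qed
  then obtain y z where "z \<in> Z" "z \<notin> Bad h u" "y \<in> Core (r # h) u" "{y, z} \<in> Mset (r # h)"
    using Core_mono by blast
  then show ?case by (intro bexI[of _ z]) (auto simp: bad_def simp del: Core.simps)
qed auto

text \<open>If \<open>n div 16\<close> vertices were bad, their box would never have been hit. Each
  of them accounts for \<open>q\<close> lost pairs with the core, but core vertices join with few
  claimed edges and the load of the box is bounded, so there are not that many lost pairs.\<close>

lemma card_Bad:
  assumes "play h" "u < n"
  shows "card (Bad h u) < n div 16"
proof (rule ccontr)
  assume "\<not> card (Bad h u) < n div 16"
  then obtain Z where Z: "Z \<subseteq> Bad h u" "card Z = n div 16"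
    using obtain_subset_with_card_n by (metis not_less)
  have ZV: "Z \<subseteq> {..<n}" using Z Bad_lt by blast
  have al: "alive h (Bd u Z)" using Bd_alive[OF assms(1)] Z by blast
  have iI: "Bd u Z \<in> I" using assms ZV by (auto simp: I_def)
  let ?i = "Bd u Z"
  have "card {(y, z). y \<in> Core h u \<and> z \<in> Z - Bad h u \<and> y \<noteq> z \<and> {y, z} \<notin> free h}
      + q * card (Z \<inter> Bad h u) \<le> (dl + b) * card (Core h u) + 2 * ld h ?i"
  proof (rule counting[where Src = "\<lambda>h. Core h u" and Ex = "\<lambda>h. Bad h u" and Tg = "\<lambda>_. Z"
        and ok = "\<lambda>h. play h \<and> alive h ?i"])
    fix r h y
    assume "play (r # h) \<and> alive (r # h) ?i" and y: "y \<in> Core (r # h) u - Core h u"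
    then have pl: "play (r # h)" by blast
    from y obtain w where "fst r = {w, y}" "y \<notin> High h" by (auto split: if_splits)
    with play_edge[OF pl] join_le[OF pl ZV]
    show "card {z \<in> Z. z \<noteq> y \<and> {y, z} \<notin> free (r # h)} \<le> dl + b" by blast
  next
    fix r h z assume "play (r # h) \<and> alive (r # h) ?i" "z \<in> Z \<inter> (Bad (r # h) u - Bad h u)"
    then have "bad (r # h) u z" by auto
    then show "q \<le> card {y \<in> Core (r # h) u. y \<noteq> z \<and> {y, z} \<notin> free (r # h)}"
      by (simp add: bad_def)
  qed (use assms al Core_lt ZV play_tl Bad_mono Core_mono in auto)
  moreover have "Z \<inter> Bad h u = Z" using Z by blast
  ultimately have "q * (n div 16) \<le> (dl + b) * card (Core h u) + 2 * ld h ?i" using Z by simp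
  also have "\<dots> \<le> (dl + b) * (2 * q + 1) + 2 * ld h ?i"
    using card_Core[OF assms] by (intro add_right_mono mult_left_mono) auto
  finally have "real (q * (n div 16)) \<le> real ((dl + b) * (2 * q + 1) + 2 * ld h ?i)"
    by (simp only: of_nat_le_iff)
  also have "\<dots> = (real dl + b) * (2 * q + 1) + 2 * real (ld h ?i)" by (simp add: algebra_simps)
  finally have 1: "real q * real (n div 16) \<le> (real dl + b) * (2 * q + 1) + 2 * real (ld h ?i)" by (simp add: algebra_simps)
  have B: "real b \<ge> 1" using b1 by simp
  have nb: "268435456 * real b \<le> n" using n_big(1) by linarith
  have "D \<le> D ^ k" using D1 k2 by (simp add: self_le_power)
  then have Dn: "real D \<le> real n" using Dk by simp
  have "real (ld h ?i) \<le> 4 * real b * (lam + n)" using ld_bound[OF assms(1) iI al] by simp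
  also have "\<dots> \<le> 4 * real b * (2 * n)" using lam Dn by (intro mult_left_mono) auto
  finally have 2: "2 * real (ld h ?i) \<le> 16 * (real b * n)" by simp
  have "real dl \<le> n / 256" unfolding dl by linarith
  then have dl': "real dl + b \<le> n / 256 + b" by simp
  have "(real dl + b) * (2 * q + 1) \<le> (n / 256 + b) * (2049 * real b)"
    using dl' B by (intro mult_mono) (auto simp: q)
  also have "\<dots> \<le> (n / 256 + n / 256) * (2049 * real b)"
    using nb B by (intro mult_right_mono) auto
  also have "\<dots> = 2049 / 128 * (real b * n)" by simp
  also have "\<dots> \<le> 17 * (real b * n)" by (intro mult_right_mono) auto
  finally have 3: "(real dl + b) * (2 * q + 1) \<le> 17 * (real b * n)" by simp
  have "real (n div 16) \<ge> n / 16 - 1" by linarith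
  then have "real q * real (n div 16) \<ge> real q * (n / 17)" using nb B by (intro mult_left_mono) linarith+
  also have "real q * (n / 17) = 1024 / 17 * (real b * n)" by (simp add: q)
  \<comment> \<open>In units of \<open>b * n\<close> the bad vertices need more than 60 lost pairs,
    while joining core vertices supply at most 17 and the load at most 16.\<close>
  finally have "1024 / 17 * (real b * n) \<le> 33 * (real b * n)" using 1 2 3 by linarith
  moreover have "real b * n > 0" using B nb by simp
  ultimately show False by simp
qed

end

text \<open>Each of the \<open>n div m\<close> full blocks contains \<open>card Q\<close> such
  numbers, and since \<open>m \<le> n\<close> the full blocks make up at least half of the
  range.\<close>

lemma card_mod_class_ge:
  fixes m n :: nat
  assumes Q: "Q \<subseteq> {..<m}" "m \<le> 2 * card Q" and m: "0 < m" "m \<le> n"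
  shows "n \<le> 4 * card {z. z < n \<and> z mod m \<in> Q}"
proof -
  have finQ: "finite Q" using Q(1) finite_subset by blast
  have "card (Q \<times> {..<n div m}) \<le> card {z. z < n \<and> z mod m \<in> Q}"
  proof (rule card_inj_on_le[where f = "\<lambda>(c, i). c + i * m"])
    show "inj_on (\<lambda>(c, i). c + i * m) (Q \<times> {..<n div m})"
    proof (rule inj_onI, clarify)
      fix c i c' i' assume c: "c \<in> Q" "c' \<in> Q" and eq: "c + i * m = c' + i' * m"
      then have lt: "c < m" "c' < m" using Q(1) by auto
      have "(c + i * m) mod m = (c' + i' * m) mod m" "(c + i * m) div m = (c' + i' * m) div m"
        using eq by simp_all
      with lt m(1) show "c = c' \<and> i = i'" by simp
    qed
    show "(\<lambda>(c, i). c + i * m) ` (Q \<times> {..<n div m}) \<subseteq> {z. z < n \<and> z mod m \<in> Q}"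
    proof clarify
      fix c i assume c: "c \<in> Q" "i < n div m"
      then have "c < m" using Q(1) by auto
      moreover have "Suc i * m \<le> n div m * m" using c(2) by (intro mult_right_mono) auto
      moreover have "n div m * m \<le> n" by simp
      ultimately have "c + i * m < n" by (metis add_less_mono1 mult_Suc order_less_le_trans)
      with \<open>c < m\<close> c show "c + i * m < n \<and> (c + i * m) mod m \<in> Q" by simp
    qed
  qed auto
  then have 1: "card Q * (n div m) \<le> card {z. z < n \<and> z mod m \<in> Q}"
    by (simp add: card_cartesian_product)
  have "0 < n div m" using m by (simp add: div_greater_zero_iff)
  then have "m \<le> m * (n div m)" by simp
  moreover have "n \<le> m * (n div m) + m"
    using mult_div_mod_eq[of m n] mod_less_divisor[OF m(1), of n] by linarith
  ultimately have "n \<le> 2 * (m * (n div m))" by linarith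
  also have "\<dots> \<le> 2 * (2 * card Q * (n div m))" using Q(2) by (intro mult_left_mono mult_right_mono) auto
  finally show ?thesis using 1 by simp
qed

section \<open>Growth of the balls in residue classes\<close>

context maker_game
begin

text \<open>The number of rounds granted to one level. A box of level \<open>j\<close> left unhit
  for so long gathers pressure \<open>T * n * D ^ j / 64 = 8 * n ^ 2 * D ^ Suc j\<close>, twice what
  the potential allows.\<close>

definition T :: nat where "T = 512 * n * D"

lemma Good_mono: "Good h j v u \<subseteq> Good (r # h) j v u" by auto

lemma pow_le_n: "j \<le> k \<Longrightarrow> D ^ j \<le> n"
  using power_increasing[of j k D] D1 Dk by linarith

lemma GoodI:
  "w \<in> Ball h j v \<Longrightarrow> fst r = {w, z} \<Longrightarrow> z \<notin> High h \<Longrightarrow> z \<notin> Bad h u \<Longrightarrow> z \<in> Good (r # h) j v u"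
  unfolding Good.simps by (intro UnI2 CollectI bexI[of _ w] conjI)

lemma Lev_in_I: "v < n \<Longrightarrow> u < n \<Longrightarrow> j < k - 1 \<Longrightarrow> Q \<subseteq> {..<D ^ Suc j} \<Longrightarrow> Lev v u j Q \<in> I"
  unfolding I_def by (intro UnI1 image_eqI[of _ _ "(v, u, j, Q)"]) auto

text \<open>A hit of the box would put a vertex with class in \<open>Q\<close> into
  \<open>Good\<close>.\<close>

lemma Lev_alive:
  assumes "play h" "(\<lambda>z. z mod D ^ Suc j) ` Good h j v u \<inter> Q = {}"
  shows "alive h (Lev v u j Q)"
  using assms
proof (induction h rule: list.induct)
  case (Cons r h)
  have "(\<lambda>z. z mod D ^ Suc j) ` Good h j v u \<inter> Q = {}" 
    using Cons.prems(2) image_mono[OF Good_mono[of h j v u r]] by (meson Int_mono disjoint_iff subsetD)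
  then have "alive h (Lev v u j Q)" by (rule Cons.IH[OF play_tl[OF Cons.prems(1)]])
  moreover have "fst r \<notin> A h (Lev v u j Q)"
  proof
    assume "fst r \<in> A h (Lev v u j Q)"
    then have "fst r \<in> pairs (Ball h j v) ({z. z < n \<and> z mod D ^ Suc j \<in> Q} - (High h \<union> Bad h u))"
      unfolding A.simps by (rule IntD2)
    then obtain w z where wz: "fst r = {w, z}" "w \<in> Ball h j v"
        "z \<in> {z. z < n \<and> z mod D ^ Suc j \<in> Q} - (High h \<union> Bad h u)"
      by (rule pairsE)
    have "z \<notin> High h \<and> z \<notin> Bad h u" "z mod D ^ Suc j \<in> Q" using wz(3) by (simp_all del: power_Suc)
    then have "z \<in> Good (r # h) j v u" using wz(1,2) by (intro GoodI) auto
    then have "z mod D ^ Suc j \<in> (\<lambda>z. z mod D ^ Suc j) ` Good (r # h) j v u" by (rule imageI)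
    with Cons.prems(2) \<open>z mod D ^ Suc j \<in> Q\<close> show False by (metis disjoint_iff)
  qed
  ultimately show ?case by simp
qed simp

lemma card_High_le:
  assumes "play h" "length h \<le> k * T"
  shows "128 * card (High h) \<le> n"
proof -
  have "512 * dl \<ge> n" unfolding dl using n_big(1) b1 by linarith
  then have "n * card (High h) \<le> 512 * (dl * card (High h))" by simp
  also have "\<dots> \<le> 512 * (2 * ((b + 1) * length h))" using card_High[OF assms(1)] by simp
  also have "\<dots> \<le> 512 * (2 * ((2 * b) * (k * T)))" using assms(2) b1 by (intro mult_left_mono mult_mono) auto
  also have "\<dots> = n * (1048576 * (k * b * D))" by (simp add: T_def)
  finally have "n * card (High h) \<le> n * (1048576 * (k * b * D))" .
  then have "card (High h) \<le> 1048576 * (k * b * D)" using n_big(1) b1 by simp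
  \<comment> \<open>The constant in \<open>bD\<close> is \<open>128 * 1048576\<close>.\<close>
  then show ?thesis using bD by linarith
qed

lemma ld_Lev:
  assumes "play h" "Lev v u j Q \<in> I" "alive h (Lev v u j Q)"
  shows "real (ld h (Lev v u j Q)) \<le> 8 * real b * real D ^ Suc j"
proof -
  have "real D ^ 1 \<le> real D ^ Suc j" using D1 by (intro power_increasing) auto
  then have "lam \<le> real D ^ Suc j" using lam by simp
  then have "4 * real b * (lam + real D ^ Suc j) \<le> 4 * real b * (2 * real D ^ Suc j)"
    by (intro mult_left_mono) auto
  moreover have "real (ld h (Lev v u j Q)) \<le> 4 * real b * (lam + real D ^ Suc j)"
    using ld_bound[OF assms] by (simp del: power_Suc)
  ultimately show ?thesis by linarith
qed

text \<open>About \<open>n / 4\<close> vertices have their class in \<open>Q\<close>, and few of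
  them are high or bad. Each source joined with few lost edges, and the load of an unhit box is
  small against \<open>n * D ^ j\<close>, so most pairs of sources and targets are still
  free.\<close>

lemma Lev_size:
  assumes h: "play h" "length h \<le> k * T" and vu: "v < n" "u < n" and j: "j < k - 1"
    and Q: "Q \<subseteq> {..<D ^ Suc j}" "D ^ Suc j \<le> 2 * card Q"
    and al: "alive h (Lev v u j Q)" and Ball: "D ^ j \<le> 2 * card (Ball h j v)"
  shows "n * D ^ j \<le> 64 * card (A h (Lev v u j Q))"
proof -
  let ?i = "Lev v u j Q"
  define ZQ where "ZQ = {z. z < n \<and> z mod D ^ Suc j \<in> Q}"
  define Ex where "Ex = (\<lambda>h. High h \<union> Bad h u)"
  define S where "S = Ball h j v"
  have iI: "?i \<in> I" using vu j Q(1) by (rule Lev_in_I)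
  have SV: "S \<subseteq> {..<n}" unfolding S_def by (rule Ball_lt[OF h(1) vu(1)])
  have finS: "finite S" "finite ZQ" using finite_subset[OF SV] by (simp_all add: ZQ_def)
  have "card {(y, z). y \<in> Ball h j v \<and> z \<in> ZQ - Ex h \<and> y \<noteq> z \<and> {y, z} \<notin> free h}
      + 0 * card (ZQ \<inter> Ex h) \<le> (dl + b) * card (Ball h j v) + 2 * ld h ?i"
  proof (rule counting[where Src = "\<lambda>h. Ball h j v" and Ex = Ex and Tg = "\<lambda>_. ZQ"
        and ok = "\<lambda>h. play h \<and> alive h ?i"])
    fix r h y
    assume "play (r # h) \<and> alive (r # h) ?i" and y: "y \<in> Ball (r # h) j v - Ball h j v"
    then have pl: "play (r # h)" by blast
    from y obtain w where "fst r = {w, y}" "y \<notin> High h" by (auto split: nat.splits)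
    moreover have "ZQ \<subseteq> {..<n}" by (auto simp: ZQ_def)
    ultimately show "card {z \<in> ZQ. z \<noteq> y \<and> {y, z} \<notin> free (r # h)} \<le> dl + b"
      using play_edge[OF pl] join_le[OF pl] by blast
  next
    fix r h show "Ex h \<subseteq> Ex (r # h)" using High_mono Bad_mono by (fastforce simp: Ex_def)
  next
    fix h show "A h ?i = free h \<inter> pairs (Ball h j v) (ZQ - Ex h)" by (simp add: ZQ_def Ex_def)
  qed (use h vu al Ball_lt play_tl Ball_mono in \<open>auto simp: ZQ_def\<close>)
  then have N: "card {(y, z). y \<in> S \<and> z \<in> ZQ - Ex h \<and> y \<noteq> z \<and> {y, z} \<notin> free h}
      \<le> (dl + b) * card S + 2 * ld h ?i" by (simp add: S_def)
  have fr: "card {(y, z). y \<in> S \<and> z \<in> ZQ - Ex h \<and> {y, z} \<in> free h} \<le> 2 * card (A h ?i)"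
  proof (rule card_pairs_le)
    show "finite (A h ?i)" using A_free finite_Kn_edges by (meson finite_Diff finite_subset)
    fix y z assume "(y, z) \<in> {(y, z). y \<in> S \<and> z \<in> ZQ - Ex h \<and> {y, z} \<in> free h}"
    then have "y \<in> Ball h j v" "z \<in> ZQ - (High h \<union> Bad h u)" "{y, z} \<in> free h"
      by (simp_all add: S_def Ex_def)
    then show "{y, z} \<in> A h ?i" unfolding A.simps ZQ_def by (blast intro: pairsI)
  qed
  \<comment> \<open>All pairs split into lost pairs, free pairs and the diagonal.\<close>
  have "card S * card (ZQ - Ex h) = card (S \<times> (ZQ - Ex h))" by (simp add: card_cartesian_product)
  also have "\<dots> \<le> card (({(y, z). y \<in> S \<and> z \<in> ZQ - Ex h \<and> y \<noteq> z \<and> {y, z} \<notin> free h}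
      \<union> {(y, z). y \<in> S \<and> z \<in> ZQ - Ex h \<and> {y, z} \<in> free h}) \<union> (\<lambda>y. (y, y)) ` S)"
    by (rule card_mono, rule finite_subset[of _ "S \<times> (ZQ \<union> S)"]) (use finS in auto)
  also have "\<dots> \<le> card {(y, z). y \<in> S \<and> z \<in> ZQ - Ex h \<and> y \<noteq> z \<and> {y, z} \<notin> free h}
      + card {(y, z). y \<in> S \<and> z \<in> ZQ - Ex h \<and> {y, z} \<in> free h} + card S"
    by (intro order.trans[OF card_Un_le] add_mono card_image_le card_Un_le finS)
  finally have 1: "card S * card (ZQ - Ex h) \<le> (dl + b) * card S + 2 * ld h ?i + 2 * card (A h ?i) + card S"
    using N fr by linarith
  have "n \<le> 4 * card ZQ" unfolding ZQ_def
    by (rule card_mod_class_ge) (use Q D1 pow_le_n[of "Suc j"] j in auto)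
  moreover have "card ZQ \<le> card (ZQ - Ex h) + card (Ex h)"
    using finS(2) card_Un_le[of "ZQ - Ex h" "Ex h"] card_mono[of "(ZQ - Ex h) \<union> Ex h" ZQ]
    by (auto simp: Ex_def High_def finite_Bad)
  moreover have "card (Ex h) \<le> card (High h) + card (Bad h u)" unfolding Ex_def by (rule card_Un_le)
  moreover have "128 * card (High h) \<le> n" by (rule card_High_le[OF h])
  moreover have "16 * card (Bad h u) \<le> n" using card_Bad[OF h(1) vu(2)] by linarith
  moreover have "256 * dl \<le> n" unfolding dl by simp
  \<comment> \<open>From \<open>n / 4\<close> targets, \<open>n / 128\<close> high and
    \<open>n / 16\<close> bad ones are subtracted; the rest covers \<open>n / 8\<close> and the loss
    \<open>dl + b\<close> of a source together with its diagonal pair.\<close>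
  ultimately have 2: "n + 8 * (dl + b + 1) \<le> 8 * card (ZQ - Ex h)"
    using n_big(1) b1 by simp
  have "card S * (n + 8 * (dl + b + 1)) \<le> card S * (8 * card (ZQ - Ex h))"
    using 2 by (intro mult_left_mono) auto
  also have "\<dots> \<le> 8 * ((dl + b) * card S + 2 * ld h ?i + 2 * card (A h ?i) + card S)"
    using 1 by simp
  finally have 3: "card S * n \<le> 16 * ld h ?i + 16 * card (A h ?i)"
    by (simp add: algebra_simps)
  have 4: "D ^ j * n \<le> 2 * (card S * n)"
    using mult_right_mono[OF Ball, of n] by (simp add: S_def)
  have "real (ld h ?i) \<le> 8 * real b * real D ^ Suc j" by (rule ld_Lev[OF h(1) iI al])
  then have "real (ld h ?i) \<le> real (8 * b * D * D ^ j)" by simp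
  then have "ld h ?i \<le> 8 * b * D * D ^ j" unfolding of_nat_le_iff .
  then have "1024 * ld h ?i \<le> 8192 * (b * D) * D ^ j" by (simp add: mult_ac)
  also have "\<dots> \<le> n * D ^ j" using n_big(2) by (intro mult_right_mono) auto
  finally have "1024 * ld h ?i \<le> D ^ j * n" by (simp add: mult.commute)
  with 3 4 have "D ^ j * n \<le> 64 * card (A h ?i)" by linarith
  then show ?thesis by (simp add: mult.commute)
qed

text \<open>From round \<open>j * T\<close> on the ball of level \<open>j\<close> is large, so each
  round adds at least \<open>n * D ^ j / 64\<close> to the pressure of the unhit box.\<close>

lemma Lev_pressure:
  assumes vu: "v < n" "u < n" and j: "j < k - 1"
    and Q: "Q \<subseteq> {..<D ^ Suc j}" "D ^ Suc j \<le> 2 * card Q"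
    and IH: "\<And>h. play h \<Longrightarrow> j * T \<le> length h \<Longrightarrow> D ^ j \<le> 2 * card (Ball h j v)"
    and h: "play h" "length h \<le> k * T" "alive h (Lev v u j Q)"
  shows "(length h - j * T) * (n * D ^ j) \<le> 64 * pr h (Lev v u j Q)"
  using h
proof (induction h rule: list.induct)
  case (Cons r h)
  let ?i = "Lev v u j Q"
  have pl: "play h" "length h \<le> k * T" "alive h ?i" using Cons.prems play_tl by auto
  note IHh = Cons.IH[OF pl]
  show ?case
  proof (cases "j * T \<le> length h")
    case True
    have "n * D ^ j \<le> 64 * card (A h ?i)"
      by (rule Lev_size[OF pl(1,2) vu j Q pl(3) IH[OF pl(1) True]])
    moreover have "length (r # h) - j * T = Suc (length h - j * T)" using True by simp
    ultimately show ?thesis using IHh by (simp del: A.simps)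
  qed simp
qed simp

text \<open>Otherwise at least half of the classes are missed. They form a set \<open>Q\<close>
  whose box is still alive, and \<open>T\<close> rounds of its pressure contradict
  \<open>pr_bound\<close>.\<close>

lemma Good_size_step:
  assumes vu: "v < n" "u < n" and j: "j < k - 1"
    and IH: "\<And>h. play h \<Longrightarrow> j * T \<le> length h \<Longrightarrow> D ^ j \<le> 2 * card (Ball h j v)"
    and h: "play h" "Suc j * T \<le> length h"
  shows "D ^ Suc j \<le> 2 * card ((\<lambda>z. z mod D ^ Suc j) ` Good h j v u)"
  using h
proof (induction h rule: list.induct)
  case Nil
  have "T > 0" using n_big(1) b1 D1 by (simp add: T_def)
  with Nil show ?case by simp
next
  case (Cons r h)
  let ?m = "D ^ Suc j"
  have fin: "finite (Good (r # h) j v u)"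
    by (rule finite_subset[OF subset_trans[OF Good_Ball Ball_lt[OF Cons.prems(1) vu(1)]] finite_lessThan])
  show ?case
  proof (cases "Suc j * T \<le> length h")
    case True
    have "card ((\<lambda>z. z mod ?m) ` Good h j v u) \<le> card ((\<lambda>z. z mod ?m) ` Good (r # h) j v u)"
      using fin Good_mono by (intro card_mono finite_imageI image_mono)
    with Cons.IH[OF play_tl[OF Cons.prems(1)] True] show ?thesis by linarith
  next
    case False
    \<comment> \<open>The bound is proved in the round in which it falls due and inherited
      afterwards, since \<open>Lev_pressure\<close> covers only the first \<open>k * T\<close>
      rounds.\<close>
    then have len: "length (r # h) = Suc j * T" using Cons.prems(2) by simp
    define g where "g = r # h"
    show ?thesis
    proof (rule ccontr)
      assume neg: "\<not> ?thesis"
      define R where "R = (\<lambda>z. z mod ?m) ` Good g j v u"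
      define Q where "Q = {..<?m} - R"
      have m: "?m > 0" using D1 by simp
      have "R \<subseteq> {..<?m}" using m by (auto simp: R_def simp del: power_Suc)
      then have "card Q = ?m - card R" using fin by (simp add: Q_def R_def g_def card_Diff_subset del: power_Suc)
      then have Q: "Q \<subseteq> {..<?m}" "?m \<le> 2 * card Q" using neg by (auto simp: Q_def R_def g_def)
      have iI: "Lev v u j Q \<in> I" using vu j Q(1) by (rule Lev_in_I)
      have g: "play g" "length g = Suc j * T" using Cons.prems len by (auto simp: g_def)
      have al: "alive g (Lev v u j Q)" by (rule Lev_alive) (use g in \<open>auto simp: Q_def R_def\<close>)
      have "Suc j * T \<le> k * T" using j by (intro mult_right_mono) auto
      then have "(length g - j * T) * (n * D ^ j) \<le> 64 * pr g (Lev v u j Q)"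
        using g by (intro Lev_pressure vu j Q IH al) auto
      then have "T * (n * D ^ j) \<le> 64 * pr g (Lev v u j Q)" using g by simp
      then have "real (T * (n * D ^ j)) \<le> real (64 * pr g (Lev v u j Q))" unfolding of_nat_le_iff .
      then have 1: "512 * (real n * real n) * (real D ^ Suc j) \<le> 64 * real (pr g (Lev v u j Q))"
        by (simp add: T_def mult_ac)
      have n2: "n \<ge> 2" using n_big(1) b1 by linarith
      have "{0, 1} \<in> Kn_edges n" using n2 by (auto simp: edge_in_Kn)
      then have "real (pr g (Lev v u j Q)) \<le> 4 * real (card (Kn_edges n)) * (lam + real D ^ Suc j)"
        using pr_bound[OF g(1) iI al] by (auto simp del: power_Suc)
      also have "\<dots> \<le> 4 * (real n * real n / 2) * (2 * real D ^ Suc j)"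
      proof (rule mult_mono)
        have "2 * card (Kn_edges n) \<le> n * n" using card_Kn_edges[of n] by simp
        then have "real (2 * card (Kn_edges n)) \<le> real (n * n)" unfolding of_nat_le_iff .
        then show "4 * real (card (Kn_edges n)) \<le> 4 * (real n * real n / 2)" by simp
        have "real D ^ 1 \<le> real D ^ Suc j" using D1 by (intro power_increasing) auto
        then show "lam + real D ^ Suc j \<le> 2 * real D ^ Suc j" using lam by simp
      qed (use lam in auto)
      finally have 2: "real (pr g (Lev v u j Q)) \<le> 4 * (real n * real n) * real D ^ Suc j" by simp
      have "real n * real n * real D ^ Suc j > 0" using n2 D1 by simp
      with 1 2 show False by (simp add: mult.assoc del: power_Suc)
    qed
  qed
qed

lemma Ball_size:
  assumes "v < n" "j \<le> k - 1" "play h" "j * T \<le> length h"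
  shows "D ^ j \<le> 2 * card (Ball h j v)"
  using assms(2-)
proof (induction j arbitrary: h)
  case 0
  then show ?case by (simp add: Ball_0)
next
  case (Suc j)
  \<comment> \<open>Any \<open>u\<close> would serve here; \<open>v\<close> itself is taken.\<close>
  have "D ^ Suc j \<le> 2 * card ((\<lambda>z. z mod D ^ Suc j) ` Good h j v v)"
    by (rule Good_size_step) (use Suc assms(1) in auto)
  moreover have fin: "finite (Ball h (Suc j) v)"
    using Ball_lt[OF Suc.prems(2) assms(1)] finite_subset by blast
  moreover have "card ((\<lambda>z. z mod D ^ Suc j) ` Good h j v v) \<le> card (Good h j v v)"
    using finite_subset[OF Good_Ball fin] by (rule card_image_le)
  moreover have "card (Good h j v v) \<le> card (Ball h (Suc j) v)"
    using fin Good_Ball by (rule card_mono)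
  ultimately show ?case by linarith
qed

corollary Good_size:
  assumes "v < n" "u < n" "play h" "(k - 1) * T \<le> length h"
  shows "D ^ (k - 1) \<le> 2 * card (Good h (k - 2) v u)"
proof -
  have k: "k - 1 = Suc (k - 2)" using k2 by simp
  have "D ^ Suc (k - 2) \<le> 2 * card ((\<lambda>z. z mod D ^ Suc (k - 2)) ` Good h (k - 2) v u)"
    by (rule Good_size_step) (use assms k Ball_size in auto)
  moreover have "finite (Good h (k - 2) v u)"
    by (rule finite_subset[OF subset_trans[OF Good_Ball Ball_lt[OF assms(3,1)]] finite_lessThan])
  then have "card ((\<lambda>z. z mod D ^ Suc (k - 2)) ` Good h (k - 2) v u) \<le> card (Good h (k - 2) v u)"
    by (rule card_image_le)
  ultimately show ?thesis unfolding k by linarith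
qed

end

section \<open>Joining the balls of two vertices\<close>

context maker_game
begin

text \<open>This is what results when the core of \<open>u\<close> is completed first: a good vertex
  that joins while the core of \<open>v\<close> still grows enters that core, and one that joins
  after the core of \<open>u\<close> is full is late.\<close>

definition split_ok :: "nat set hist \<Rightarrow> nat \<Rightarrow> nat \<Rightarrow> bool" where
  "split_ok h v u \<longleftrightarrow> Good h (k - 2) v u \<subseteq> Late h v u \<union> Core h v"

lemma split_ok_step:
  assumes "split_ok h v u" "full h u \<or> \<not> full h v"
  shows "split_ok (r # h) v u"
  unfolding split_ok_def
proof
  fix z assume "z \<in> Good (r # h) (k - 2) v u"
  then consider "z \<in> Good h (k - 2) v u"
    | w where "w \<in> Ball h (k - 2) v" "fst r = {w, z}" "z \<notin> High h" "z \<notin> Bad h u"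
    by auto
  then show "z \<in> Late (r # h) v u \<union> Core (r # h) v"
  proof cases
    case 1
    with assms(1) show ?thesis by (auto simp: split_ok_def)
  next
    case 2
    then have "z \<in> Late (r # h) v u" if "full h u" using that unfolding Late.simps by auto
    moreover have "z \<in> Core (r # h) v" if "\<not> full h v" using that 2 unfolding Core.simps full_def by auto
    ultimately show ?thesis using assms(2) by blast
  qed
qed

text \<open>The core of \<open>u\<close> or that of \<open>v\<close> is completed first; all good vertices that
  join the ball of the other one after that are late.\<close>

lemma split_ok:
  assumes "play h" "u < n" "v < n"
  shows "split_ok h v u \<or> split_ok h u v"
proof -
  \<comment> \<open>The three states: the core of \<open>u\<close> was completed first, that of
    \<open>v\<close> was, or neither is full yet.\<close>
  have "(split_ok h v u \<and> full h u) \<or> (split_ok h u v \<and> full h v) \<or>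
      (split_ok h v u \<and> split_ok h u v \<and> \<not> full h u \<and> \<not> full h v)"
    using assms(1)
  proof (induction h rule: list.induct)
    case Nil
    have "q > 0" using q b1 by simp
    then show ?case by (auto simp: split_ok_def full_def)
  next
    case (Cons r h)
    note fm = full_mono[OF Cons.prems assms(2)] full_mono[OF Cons.prems assms(3)]
    from Cons.IH[OF play_tl[OF Cons.prems]] show ?case
      using split_ok_step[of h v u r] split_ok_step[of h u v r] fm by blast
  qed
  then show ?thesis by blast
qed

lemma conn_through:
  assumes "z \<in> Ball h (k - 1) u" "y \<in> Ball h' (k - 1) v" "{z, y} \<in> M"
    and "Mset h \<subseteq> M" "Mset h' \<subseteq> M"
  shows "conn M (2 * k - 1) u v"
proof -
  have "conn M (k - 1) u z" using Ball_conn[OF assms(1)] conn_mono assms(4) by blast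
  moreover have "conn M (Suc 0) z y" using assms(3) by (rule conn_edge)
  moreover have "conn M (k - 1) y v" using Ball_conn[OF assms(2)] conn_mono conn_sym assms(5) by blast
  ultimately have "conn M ((k - 1) + (Suc 0 + (k - 1))) u v" using conn_trans by blast
  moreover have "(k - 1) + (Suc 0 + (k - 1)) = 2 * k - 1" using k2 by simp
  ultimately show ?thesis by argo
qed

text \<open>A hit is an edge between subsets of the two balls of radius
  \<open>k - 1\<close>.\<close>

lemma Pr_alive:
  assumes "play h" "\<not> alive h (Pr u v)"
  shows "conn (Mset h) (2 * k - 1) u v"
  using assms
proof (induction h rule: list.induct)
  case (Cons r h)
  have sub: "Mset h \<subseteq> Mset (r # h)" "fst r \<in> Mset (r # h)" by (cases r; auto)+
  show ?case
  proof (cases "alive h (Pr u v)")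
    case True
    then have "fst r \<in> A h (Pr u v)" using Cons.prems(2) by simp
    then have "fst r \<in> pairs (Late h v u) (Core h u)" by simp
    then obtain y z where yz: "fst r = {y, z}" "y \<in> Late h v u" "z \<in> Core h u" by (rule pairsE)
    have "{z, y} \<in> Mset (r # h)" using sub(2) yz(1) by (simp add: insert_commute)
    then show ?thesis using conn_through[OF _ _ _ sub(1) sub(1)] yz Core_Ball Late_Ball by blast
  next
    case False
    with Cons.IH[OF play_tl[OF Cons.prems(1)]] show ?thesis using conn_mono[OF _ sub(1)] by blast
  qed
qed simp

lemma not_bad: "y \<notin> Bad h u \<Longrightarrow> y < n \<Longrightarrow> \<not> bad h u y"
proof -
  assume y: "y \<notin> Bad h u" "y < n"
  \<comment> \<open>In the initial position the core is empty, and \<open>0 < q\<close> keeps it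
    from counting as full.\<close>
  have "0 < q" using q b1 by simp
  with y show "\<not> bad h u y" by (cases h) (auto simp: bad_def full_def)
qed

text \<open>A late vertex is not bad for \<open>u\<close> when it joins. An edge of Maker from it to
  the core would already connect \<open>u\<close> and \<open>v\<close>, so it has lost fewer than
  \<open>q\<close> edges to the core, and at most \<open>b + 1\<close> more in that round. All
  further losses are load.\<close>

lemma Pr_lost:
  assumes uv: "u < n" "v < n" and h: "play h" "\<not> conn (Mset h) (2 * k - 1) u v"
  shows "card {(y, z). y \<in> Late h v u \<and> z \<in> Core h u \<and> y \<noteq> z \<and> {y, z} \<notin> free h}
    \<le> (q + b) * card (Late h v u) + 2 * ld h (Pr u v)"
proof -
  let ?i = "Pr u v"
  have LateV: "Late h v u \<subseteq> {..<n}" if "play h" for h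
    using Late_Ball Ball_lt[OF that uv(2)] by blast
  have "card {(y, z). y \<in> Late h v u \<and> z \<in> Core h u - {} \<and> y \<noteq> z \<and> {y, z} \<notin> free h}
      + 0 * card (Core h u \<inter> {}) \<le> (q + b) * card (Late h v u) + 2 * ld h ?i"
  proof (rule counting[where Src = "\<lambda>h. Late h v u" and Ex = "\<lambda>_. {}" and Tg = "\<lambda>h. Core h u"
        and ok = "\<lambda>h. play h \<and> alive h ?i \<and> \<not> conn (Mset h) (2 * k - 1) u v"])
    show "play h \<and> alive h ?i \<and> \<not> conn (Mset h) (2 * k - 1) u v" using Pr_alive h by blast
  next
    fix r h assume *: "play (r # h) \<and> alive (r # h) ?i \<and> \<not> conn (Mset (r # h)) (2 * k - 1) u v"
    have sub: "Mset h \<subseteq> Mset (r # h)" by (cases r) auto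
    show ok: "play h \<and> alive h ?i \<and> \<not> conn (Mset h) (2 * k - 1) u v"
      using * play_tl[of r h] conn_mono[OF _ sub order.refl] by auto
    \<comment> \<open>The core grows only until it is full, and before that no vertex is
      late.\<close>
    show "Core (r # h) u = Core h u \<or> (Late h v u = {} \<and> {} = {})"
      using Late_full[OF _ uv(1)] full_Core ok by blast
    fix y assume y: "y \<in> Late (r # h) v u - Late h v u"
    have pl: "play (r # h)" using * by blast
    from y obtain w where w: "full h u" "y \<notin> Bad h u" by (auto split: if_splits)
    have yn: "y < n" using y LateV[OF pl] by blast
    have "{z, y} \<notin> Mset h" if "z \<in> Core h u" for z
    proof
      assume "{z, y} \<in> Mset h"
      then have "{z, y} \<in> Mset (r # h)" using sub by blast
      moreover have "z \<in> Ball h (k - 1) u" "y \<in> Ball (r # h) (k - 1) v"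
        using that y Core_Ball Late_Ball by blast+
      ultimately have "conn (Mset (r # h)) (2 * k - 1) u v" using conn_through sub by blast
      with * show False by blast
    qed
    then have "card {z \<in> Core h u. z \<noteq> y \<and> {z, y} \<notin> free h} < q"
      using not_bad[OF w(2) yn] w(1) by (auto simp: bad_def)
    then have "card {z \<in> Core h u. z \<noteq> y \<and> {y, z} \<notin> free h} < q" by (simp add: insert_commute)
    with lost_le[OF pl Core_lt[OF play_tl[OF pl] uv(1)], of y]
    show "card {z \<in> Core (r # h) u. z \<noteq> y \<and> {y, z} \<notin> free (r # h)} \<le> q + b"
      unfolding full_Core[OF w(1)] by linarith
  qed (use Core_lt uv LateV in auto)
  then show ?thesis by simp
qed

text \<open>At the end no edge is free, so every pair of a late vertex and a core vertex is lost.
  The load of an unhit \<open>Pr u v\<close> accounts for this only if there are at most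
  \<open>lam\<close> late vertices, but \<open>bDk\<close> gives more.\<close>

lemma pair_connected:
  assumes uv: "u < n" "v < n" and h: "play h" "free h = {}" "(k - 1) * T \<le> length h"
    and sp: "split_ok h v u"
  shows "conn (Mset h) (2 * k - 1) u v"
proof (rule ccontr)
  assume nc: "\<not> ?thesis"
  let ?L = "Late h v u" and ?C = "Core h u"
  have fin: "finite ?L" "finite (Core h v)" "finite ?C"
    using finite_Core h uv finite_subset[OF subset_trans[OF Late_Ball Ball_lt[OF h(1) uv(2)]]] by auto
  have "D ^ (k - 1) \<le> 2 * card (Good h (k - 2) v u)" by (rule Good_size[OF uv(2,1) h(1,3)])
  also have "card (Good h (k - 2) v u) \<le> card (?L \<union> Core h v)"
    using sp fin by (intro card_mono) (auto simp: split_ok_def)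
  also have "\<dots> \<le> card ?L + card (Core h v)" by (rule card_Un_le)
  also have "\<dots> \<le> card ?L + (2 * q + 1)" using card_Core[OF h(1) uv(2)] by simp
  finally have "D ^ (k - 1) \<le> 2 * (card ?L + (2 * q + 1))" by simp
  then have "real (D ^ (k - 1)) \<le> real (2 * (card ?L + (2 * q + 1)))" unfolding of_nat_le_iff .
  then have L: "real (card ?L) > lam" using bDk b1 lam(3) by (simp add: q)
  then have "?L \<noteq> {}" using lam(3) by auto
  then have full: "2 * q \<le> card ?C" using Late_full[OF h(1) uv(1)] by (simp add: full_def)
  have "2 * q - 1 \<le> card (?C - {y})" for y
    using full by (auto simp: card_Diff_singleton_if)
  then have "card ?L * (2 * q - 1) \<le> (\<Sum>y\<in>?L. card (?C - {y}))"
    using sum_bounded_below[of ?L "2 * q - 1" "\<lambda>y. card (?C - {y})"] by (simp add: mult.commute)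
  also have "\<dots> = card (SIGMA y:?L. ?C - {y})" using fin by (simp add: card_SigmaI)
  also have "(SIGMA y:?L. ?C - {y}) = {(y, z). y \<in> ?L \<and> z \<in> ?C \<and> y \<noteq> z \<and> {y, z} \<notin> free h}"
    using h(2) by auto
  also have "card \<dots> \<le> (q + b) * card ?L + 2 * ld h (Pr u v)"
    by (rule Pr_lost[OF uv h(1) nc])
  finally have "card ?L * (2 * q - 1) \<le> (q + b) * card ?L + 2 * ld h (Pr u v)" .
  \<comment> \<open>After cancelling \<open>q + b\<close> each late vertex still needs
    \<open>q - 1 - b \<ge> 8 * b\<close> lost pairs, against \<open>2 * 4 * b * lam\<close> from the
    load.\<close>
  moreover have "2 * q - 1 = (q + b) + (q - 1 - b)" using q b1 by simp
  ultimately have "card ?L * (q - 1 - b) \<le> 2 * ld h (Pr u v)"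
    by (simp only: distrib_left distrib_right mult.commute[of _ "card ?L"])
  moreover have "8 * b \<le> q - 1 - b" using q b1 by simp
  ultimately have "card ?L * (8 * b) \<le> 2 * ld h (Pr u v)" by (meson mult_le_mono2 order.trans)
  then have "real (card ?L * (8 * b)) \<le> real (2 * ld h (Pr u v))" unfolding of_nat_le_iff .
  moreover have "real (ld h (Pr u v)) \<le> 4 * real b * lam"
    using ld_bound[OF h(1), of "Pr u v"] Pr_alive[OF h(1)] nc uv by (auto simp: I_def)
  ultimately have "real b * real (card ?L) \<le> real b * lam" by simp
  with L b1 show False by simp
qed

lemma play_Mset: "play h \<Longrightarrow> Mset h \<subseteq> Kn_edges n"
proof (induction h)
  case (Cons r h)
  obtain e C where r: "r = (e, C)" by force
  then show ?case using Cons playD[of e C h] by (auto simp: free_def)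
qed simp

theorem maker_wins_diameter:
  assumes s: "2 * k - 1 \<le> s" and b': "b' \<le> b"
  shows "maker_wins (Kn_edges n) (diam_winning_sets s n) b'"
proof (rule maker_wins_by_strategy[OF finite_Kn_edges strat(1) _ b'])
  fix h assume pl: "play h" and fin: "Kn_edges n - Mset h - Bset h = {}"
  have fr: "free h = {}" using fin by (simp add: free_def)
  \<comment> \<open>In fewer rounds only a small fraction of the edges could have been
    claimed.\<close>
  have len: "(k - 1) * T \<le> length h"
  proof (rule ccontr)
    assume "\<not> ?thesis"
    then have "length h \<le> k * T" by (metis diff_le_self mult_le_mono1 nat_le_linear order.trans)
    have "card (Kn_edges n) \<le> card (Mset h \<union> Bset h)"
      using fin card_claimed[OF pl] by (intro card_mono) auto
    also have "\<dots> \<le> (b + 1) * length h" using card_claimed[OF pl] by simp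
    also have "\<dots> \<le> (2 * b) * (k * T)" using \<open>length h \<le> k * T\<close> b1 by (intro mult_mono) auto
    finally have "n * (n - 1) \<le> 2 * ((2 * b) * (k * T))" using card_Kn_edges[of n] by linarith
    also have "\<dots> = n * (2048 * (k * b * D))" by (simp add: T_def)
    finally have "n - 1 \<le> 2048 * (k * b * D)" using n_big(1) b1 by simp
    then show False using bD n_big(1) b1 by linarith
  qed
  have "path_within (Mset h) s u v" if "u < n" "v < n" for u v
  proof -
    have "conn (Mset h) (2 * k - 1) u v"
      using split_ok[OF pl that] pair_connected[OF that pl fr len]
        pair_connected[OF that(2,1) pl fr len] conn_sym by blast
    then show ?thesis using conn_mono s by (auto simp: path_within_iff_conn)
  qed
  then have "Mset h \<in> diam_winning_sets s n"
    using play_Mset[OF pl] by (simp add: diam_winning_sets_def)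
  then show "\<exists>W\<in>diam_winning_sets s n. W \<subseteq> Mset h" by blast
qed auto

end

section \<open>Breaker's strategy\<close>

text \<open>Breaker needs only the set \<open>R\<close>, but his turn forces him to claim a
  prescribed number of elements, so the invariant must survive every superset \<open>S\<close>. By
  rule induction no position with the invariant is winning for Maker.\<close>

lemma breaker_wins_by_invariant:
  assumes fin: "finite X"
    and step: "\<And>M B e. Inv M B \<Longrightarrow> e \<in> X - M - B \<Longrightarrow>
      \<exists>R. R \<subseteq> X - insert e M - B \<and> card R \<le> b \<and>
        (\<forall>S. R \<subseteq> S \<longrightarrow> S \<subseteq> X - insert e M - B \<longrightarrow> Inv (insert e M) (B \<union> S))"
    and final: "\<And>M B W. Inv M B \<Longrightarrow> X - M - B = {} \<Longrightarrow> W \<in> F \<Longrightarrow> \<not> W \<subseteq> M"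
    and init: "Inv {} {}"
  shows "breaker_wins X F b"
proof -
  define after where "after = (\<lambda>M B. \<exists>M' e. M = insert e M' \<and> Inv M' B \<and> e \<in> X - M' - B)"
  have after: "\<exists>R. R \<subseteq> X - M - B \<and> card R \<le> b \<and>
      (\<forall>S. R \<subseteq> S \<longrightarrow> S \<subseteq> X - M - B \<longrightarrow> Inv M (B \<union> S))" if M: "after M B" for M B
  proof -
    from M obtain M' e where M': "M = insert e M'" "Inv M' B" "e \<in> X - M' - B"
      unfolding after_def by blast
    show ?thesis using step[OF M'(2,3)] unfolding M'(1) .
  qed
  have "mwin X F b t M B \<Longrightarrow> \<not> (if t then Inv M B else after M B)" for t M B
  proof (induction rule: mwin.induct)
    case (game_over M B W t)
    have "\<not> Inv M B" using final[OF _ game_over(1,2)] game_over(3) by blast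
    \<comment> \<open>If the board is exhausted by Maker's move, Breaker's answer is empty and the
      invariant holds at once.\<close>
    moreover have "Inv M B" if "after M B"
    proof -
      obtain R where R: "R \<subseteq> X - M - B" "\<And>S. R \<subseteq> S \<Longrightarrow> S \<subseteq> X - M - B \<Longrightarrow> Inv M (B \<union> S)"
        using after[OF \<open>after M B\<close>] by blast
      from R(2)[of "{}"] R(1) game_over(1) show ?thesis by simp
    qed
    ultimately show ?case by auto
  next
    case (maker_move e M B)
    then have "\<not> after (insert e M) B" by simp
    then have "\<not> Inv M B" using maker_move(1) unfolding after_def by blast
    then show ?case by simp
  next
    case (breaker_move M B)
    have False if "after M B"
    proof -
      obtain R where R: "R \<subseteq> X - M - B" "card R \<le> b"
        "\<And>S. R \<subseteq> S \<Longrightarrow> S \<subseteq> X - M - B \<Longrightarrow> Inv M (B \<union> S)"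
        using after[OF \<open>after M B\<close>] by blast
      have finY: "finite (X - M - B)" using fin by simp
      have "card R \<le> min b (card (X - M - B))" using R(2) card_mono[OF finY R(1)] by simp
      then obtain S where S: "R \<subseteq> S" "S \<subseteq> X - M - B" "card S = min b (card (X - M - B))"
        using exists_subset_between[OF _ _ R(1) finY] by (meson min.cobounded2)
      with breaker_move(2) have "\<not> Inv M (B \<union> S)" by simp
      with R(3)[OF S(1,2)] show False by blast
    qed
    then show ?case by auto
  qed
  from this[of True "{}" "{}"] init show ?thesis by (auto simp: breaker_wins_def maker_wins_def)
qed

section \<open>Balls and components of Maker's graph\<close>

definition near :: "nat set set \<Rightarrow> nat \<Rightarrow> nat \<Rightarrow> nat set" where
  "near M i u = {x. conn M i u x}"

lemma near_0: "near M 0 u = {u}"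
  by (auto simp: near_def conn_def)

lemma near_Suc: "near M (Suc i) u = near M i u \<union> {x. \<exists>y\<in>near M i u. {y, x} \<in> M}"
proof -
  have "conn M (Suc i) u x \<longleftrightarrow> conn M i u x \<or> (\<exists>y. conn M i u y \<and> {y, x} \<in> M)" for x
  proof
    assume "conn M (Suc i) u x"
    then obtain m where m: "m \<le> Suc i" "(u, x) \<in> adj M ^^ m" by (auto simp: conn_def)
    show "conn M i u x \<or> (\<exists>y. conn M i u y \<and> {y, x} \<in> M)"
    proof (cases "m \<le> i")
      case True with m show ?thesis by (auto simp: conn_def)
    next
      case False
      then have "m = Suc i" using m by simp
      with m(2) obtain y where "(u, y) \<in> adj M ^^ i" "(y, x) \<in> adj M" by auto
      then show ?thesis by (auto simp: conn_def adj_def)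
    qed
  next
    assume "conn M i u x \<or> (\<exists>y. conn M i u y \<and> {y, x} \<in> M)"
    then show "conn M (Suc i) u x"
      using conn_mono[of M i u x M "Suc i"] conn_trans[of M i u _ "Suc 0" x] conn_edge by auto
  qed
  then show ?thesis by (auto simp: near_def)
qed

lemma near_mono: "i \<le> j \<Longrightarrow> near M i u \<subseteq> near M j u"
  using conn_mono by (auto simp: near_def)

lemma near_touched: "near M i u \<subseteq> insert u (\<Union>M)"
proof (induction i)
  case (Suc i)
  have "x \<in> \<Union>M" if "{y, x} \<in> M" for x y using that by blast
  with Suc show ?case unfolding near_Suc by blast
qed (simp add: near_0)

text \<open>A walk of length at most \<open>j\<close> through \<open>e\<close> meets an end of
  \<open>e\<close> after fewer than \<open>j\<close> steps.\<close>

lemma near_insert: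
  assumes "\<And>i. i < j \<Longrightarrow> e \<inter> near M i u = {}"
  shows "near (insert e M) j u = near M j u"
  using assms
proof (induction j)
  case (Suc j)
  then have IH: "near (insert e M) j u = near M j u" and d: "e \<inter> near M j u = {}" by auto
  have "{y, x} \<noteq> e" if "y \<in> near M j u" for x y using that d by blast
  then show ?case unfolding near_Suc IH by blast
qed (simp add: near_0)

lemma conn_split: "conn M (i + j) u v \<Longrightarrow> \<exists>w. conn M i u w \<and> conn M j w v"
proof -
  assume "conn M (i + j) u v"
  then obtain m where m: "m \<le> i + j" "(u, v) \<in> adj M ^^ m" by (auto simp: conn_def)
  show ?thesis
  proof (cases "m \<le> i")
    case True
    with m(2) have "conn M i u v" by (auto simp: conn_def)
    then show ?thesis using conn_refl by blast
  next
    case False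
    then have "m = i + (m - i)" by simp
    with m(2) have "(u, v) \<in> adj M ^^ i O adj M ^^ (m - i)" by (metis relpow_add)
    then obtain w where "(u, w) \<in> adj M ^^ i" "(w, v) \<in> adj M ^^ (m - i)" by blast
    moreover have "m - i \<le> j" using m(1) by simp
    ultimately show ?thesis unfolding conn_def by blast
  qed
qed

lemma card_pairs:
  assumes "finite P" "finite Q"
  shows "finite (pairs P Q)" "card (pairs P Q) \<le> card P * card Q"
proof -
  have "pairs P Q = (\<lambda>(x, y). {x, y}) ` (P \<times> Q)" by (auto simp: pairs_def)
  then show "finite (pairs P Q)" "card (pairs P Q) \<le> card P * card Q"
    using assms card_image_le[of "P \<times> Q" "\<lambda>(x, y). {x, y}"]
    by (simp_all add: card_cartesian_product)
qed

text \<open>\<open>U\<close> and \<open>V\<close> are disjoint and closed under adjacency; they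
  witness that their members lie in different components.\<close>

definition separated :: "nat set set \<Rightarrow> nat set \<Rightarrow> nat set \<Rightarrow> bool" where
  "separated M U V \<longleftrightarrow> U \<inter> V = {} \<and> (\<forall>e\<in>M. (e \<subseteq> U \<or> e \<inter> U = {}) \<and> (e \<subseteq> V \<or> e \<inter> V = {}))"

text \<open>The end \<open>c\<close> is untouched, so the new edge is pendant and \<open>c\<close>
  can be added to the side of \<open>a\<close>.\<close>

lemma separated_step:
  assumes "separated M U V" "U \<union> V \<subseteq> T" "\<Union>M \<subseteq> T" "c \<notin> T" "a \<noteq> c"
  shows "\<exists>U' V'. separated (insert {a, c} M) U' V' \<and> U \<subseteq> U' \<and> V \<subseteq> V' \<and> U' \<union> V' \<subseteq> T \<union> {a, c}"
proof -
  define U' where "U' = (if a \<in> U then insert c U else U)"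
  define V' where "V' = (if a \<in> V then insert c V else V)"
  have disj: "U \<inter> V = {}" and cUV: "c \<notin> U" "c \<notin> V" using assms by (auto simp: separated_def)
  have old: "(e \<subseteq> U' \<or> e \<inter> U' = {}) \<and> (e \<subseteq> V' \<or> e \<inter> V' = {})" if "e \<in> M" for e
  proof -
    have "c \<notin> e" using that assms(3,4) by blast
    moreover have "(e \<subseteq> U \<or> e \<inter> U = {}) \<and> (e \<subseteq> V \<or> e \<inter> V = {})"
      using that assms(1) by (simp add: separated_def)
    ultimately show ?thesis unfolding U'_def V'_def by auto
  qed
  have "({a, c} \<subseteq> U' \<or> {a, c} \<inter> U' = {}) \<and> ({a, c} \<subseteq> V' \<or> {a, c} \<inter> V' = {})"
    using cUV by (auto simp: U'_def V'_def)
  moreover have "U' \<inter> V' = {}" using disj cUV by (auto simp: U'_def V'_def)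
  ultimately have "separated (insert {a, c} M) U' V'" using old by (simp add: separated_def)
  moreover have "U' \<union> V' \<subseteq> T \<union> {a, c}" using assms(2) by (auto simp: U'_def V'_def)
  moreover have "U \<subseteq> U'" "V \<subseteq> V'" by (auto simp: U'_def V'_def)
  ultimately show ?thesis by blast
qed

lemma near_separated:
  assumes "\<forall>e\<in>M. e \<subseteq> U \<or> e \<inter> U = {}" "u \<in> U"
  shows "near M i u \<subseteq> U"
proof (induction i)
  case (Suc i)
  have "x \<in> U" if "y \<in> U" "{y, x} \<in> M" for x y
  proof -
    have "{y, x} \<subseteq> U \<or> {y, x} \<inter> U = {}" using assms(1) that(2) by (rule bspec)
    with that(1) show ?thesis by simp
  qed
  with Suc show ?case unfolding near_Suc by blast
qed (simp add: near_0 assms(2))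

lemma separated_near:
  assumes "separated M U V" "u \<in> U" "v \<in> V"
  shows "near M i u \<inter> near M j v = {}"
proof -
  have "near M i u \<subseteq> U" using assms by (intro near_separated) (auto simp: separated_def)
  moreover have "near M j v \<subseteq> V" using assms by (intro near_separated) (auto simp: separated_def)
  moreover have "U \<inter> V = {}" using assms(1) by (simp add: separated_def)
  ultimately show ?thesis by blast
qed

text \<open>\<open>h\<close> is half of the bias. \<open>\<tau> (Suc j)\<close> bounds the touched
  vertices during stage \<open>j\<close>: the stage starts with at most \<open>\<tau> j + 2\<close>
  of them, each with at most \<open>n\<close> free edges, and every \<open>h\<close> edges closed
  cost two more touched vertices.\<close>

locale breaker_game =
  fixes n k h b s :: nat and \<tau> :: "nat \<Rightarrow> real"
  assumes k2: "k \<ge> 2" and h: "2 * h \<le> b" "h > 0" and n4: "n \<ge> 4" and s: "s \<le> 2 * k"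
    and tau0: "\<tau> 0 = 4" and tau_Suc: "\<And>i. \<tau> (Suc i) = (\<tau> i + 2) * (1 + 2 * real n / real h)"
    and tau_h: "2 * \<tau> (k - 1) + 4 \<le> real h"
begin

section \<open>Invariants for two vertices far apart\<close>

definition frees :: "nat set set \<Rightarrow> nat set set \<Rightarrow> nat set set" where
  "frees M B = Kn_edges n - M - B"

definition touched :: "nat set set \<Rightarrow> nat \<Rightarrow> nat \<Rightarrow> nat set" where
  "touched M u v = {u, v} \<union> \<Union>M"

abbreviation near2 :: "nat set set \<Rightarrow> nat \<Rightarrow> nat \<Rightarrow> nat \<Rightarrow> nat set" where
  "near2 M i u v \<equiv> near M i u \<union> near M i v"

text \<open>\<open>Inv1 j\<close>: the balls of radius \<open>j - 1\<close> are closed, those of radius \<open>j\<close> are being closed.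
  Each round touches two new vertices and closes \<open>h\<close> edges at these balls, which makes the
  left-hand side of the last condition nonincreasing.\<close>

definition Inv1 :: "nat \<Rightarrow> nat \<Rightarrow> nat \<Rightarrow> nat set set \<Rightarrow> nat set set \<Rightarrow> bool" where
  "Inv1 j u v M B \<longleftrightarrow> j \<le> k - 2 \<and> u < n \<and> v < n \<and> M \<subseteq> Kn_edges n \<and>
     (\<forall>f\<in>frees M B. \<not> f \<subseteq> touched M u v) \<and>
     (\<exists>U V. u \<in> U \<and> v \<in> V \<and> U \<union> V \<subseteq> touched M u v \<and> separated M U V) \<and>
     (\<forall>i<j. \<forall>f\<in>frees M B. f \<inter> near2 M i u v = {}) \<and>
     real (card (touched M u v)) + 2 / real h * real (card {f \<in> frees M B. f \<inter> near2 M j u v \<noteq> {}})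
       \<le> \<tau> (Suc j)"

text \<open>The last phase. No free edge meets the balls of radius \<open>k - 2\<close>, so those of
  radius \<open>k - 1\<close> are fixed; touched vertices outside them are already cut off from
  them, and the size bound pays for cutting off two more per round.\<close>

definition Inv2 :: "nat \<Rightarrow> nat \<Rightarrow> nat set set \<Rightarrow> nat set set \<Rightarrow> bool" where
  "Inv2 u v M B \<longleftrightarrow> u < n \<and> v < n \<and> M \<subseteq> Kn_edges n \<and>
     near M k u \<inter> near M k v = {} \<and>
     (\<forall>f\<in>frees M B. f \<inter> near2 M (k - 2) u v = {}) \<and>
     (\<forall>f\<in>frees M B. \<not> f \<subseteq> near2 M (k - 1) u v) \<and>
     (\<forall>y\<in>\<Union>M - near2 M (k - 1) u v. \<forall>x\<in>near2 M (k - 1) u v. {x, y} \<notin> frees M B) \<and>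
     2 * card (near2 M (k - 1) u v) \<le> b"

definition Inv :: "nat set set \<Rightarrow> nat set set \<Rightarrow> bool" where
  "Inv M B \<longleftrightarrow> (M = {} \<and> B = {}) \<or> (\<exists>j u v. Inv1 j u v M B) \<or> (\<exists>u v. Inv2 u v M B)"

section \<open>Preservation of the invariants\<close>

lemma Union_lt: "M \<subseteq> Kn_edges n \<Longrightarrow> \<Union>M \<subseteq> {..<n}"
  by (auto simp: Kn_edges_alt)

lemma touched_lt: "M \<subseteq> Kn_edges n \<Longrightarrow> u < n \<Longrightarrow> v < n \<Longrightarrow> touched M u v \<subseteq> {..<n}"
  unfolding touched_def using Union_lt[of M] by simp

lemma near2_touched: "near2 M i u v \<subseteq> touched M u v"
  unfolding touched_def using near_touched[of M i u] near_touched[of M i v] by blast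

lemma finite_frees: "finite (frees M B)"
  using finite_Kn_edges by (simp add: frees_def)

lemma frees_sub: "frees (insert e M) (B \<union> S) = frees (insert e M) B - S"
  "frees (insert e M) B = frees M B - {e}"
  by (auto simp: frees_def)

lemma edgeE:
  assumes "e \<in> frees M B"
  obtains a c where "e = {a, c}" "a \<noteq> c" "a < n" "c < n"
  using assms by (auto simp: frees_def Kn_edges_def)

lemma tau_ge: "\<tau> i \<ge> 4"
proof (induction i)
  case (Suc i)
  have "4 \<le> (\<tau> i + 2) * 1" using Suc by simp
  also have "\<dots> \<le> (\<tau> i + 2) * (1 + 2 * real n / real h)"
    using Suc by (intro mult_left_mono) auto
  finally show ?case unfolding tau_Suc .
qed (simp add: tau0)

lemma tau_mono: "i \<le> j \<Longrightarrow> \<tau> i \<le> \<tau> j"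
proof (induction rule: dec_induct)
  case (step m)
  have "\<tau> i \<le> (\<tau> m + 2) * 1" using step by simp
  also have "\<dots> \<le> (\<tau> m + 2) * (1 + 2 * real n / real h)"
    using tau_ge[of m] by (intro mult_left_mono) auto
  finally show ?case unfolding tau_Suc .
qed simp

text \<open>A free edge at the balls has an end among the touched vertices, so there are at most
  \<open>n\<close> such edges per touched vertex; the recursion of \<open>\<tau>\<close> is this
  estimate.\<close>

lemma stage_start:
  assumes j: "j \<le> k - 2" and uv: "u < n" "v < n" and M: "M \<subseteq> Kn_edges n"
    and b: "\<forall>f\<in>frees M B. \<not> f \<subseteq> touched M u v"
    and c: "\<exists>U V. u \<in> U \<and> v \<in> V \<and> U \<union> V \<subseteq> touched M u v \<and> separated M U V"
    and d: "\<forall>i<j. \<forall>f\<in>frees M B. f \<inter> near2 M i u v = {}"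
    and T: "real (card (touched M u v)) \<le> \<tau> j + 2"
  shows "Inv1 j u v M B"
proof -
  have fin: "finite (touched M u v)" using touched_lt[OF M uv] finite_subset by blast
  have finN: "finite (near2 M j u v)" using near2_touched fin by (rule finite_subset)
  have "{f \<in> frees M B. f \<inter> near2 M j u v \<noteq> {}} \<subseteq> pairs (near2 M j u v) {..<n}"
  proof
    fix f assume f: "f \<in> {f \<in> frees M B. f \<inter> near2 M j u v \<noteq> {}}"
    then have "f \<in> frees M B" by simp
    then obtain a c where ac: "f = {a, c}" "a < n" "c < n" by (rule edgeE)
    have fc: "f = {c, a}" unfolding ac by (rule insert_commute)
    from f ac(1) have "a \<in> near2 M j u v \<or> c \<in> near2 M j u v" by blast
    then show "f \<in> pairs (near2 M j u v) {..<n}"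
      using pairsI[of a "near2 M j u v" c "{..<n}"] pairsI[of c "near2 M j u v" a "{..<n}"] ac fc by auto
  qed
  then have "card {f \<in> frees M B. f \<inter> near2 M j u v \<noteq> {}} \<le> card (pairs (near2 M j u v) {..<n})"
    by (intro card_mono card_pairs finN) auto
  also have "\<dots> \<le> card (near2 M j u v) * card {..<n}"
    by (intro card_pairs finN) auto
  also have "\<dots> \<le> card (touched M u v) * n"
    using card_mono[OF fin near2_touched] by simp
  finally have "real (card {f \<in> frees M B. f \<inter> near2 M j u v \<noteq> {}}) \<le> real (card (touched M u v) * n)"
    unfolding of_nat_le_iff .
  then have "2 / real h * real (card {f \<in> frees M B. f \<inter> near2 M j u v \<noteq> {}})
      \<le> 2 / real h * (real (card (touched M u v)) * real n)"
    by (intro mult_left_mono) auto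
  then have "real (card (touched M u v)) + 2 / real h * real (card {f \<in> frees M B. f \<inter> near2 M j u v \<noteq> {}})
      \<le> real (card (touched M u v)) * (1 + 2 * real n / real h)"
    by (simp add: algebra_simps)
  also have "\<dots> \<le> (\<tau> j + 2) * (1 + 2 * real n / real h)"
    using T by (intro mult_right_mono) auto
  finally show ?thesis using assms unfolding Inv1_def tau_Suc by blast
qed

lemma Inv2_start:
  assumes uv: "u < n" "v < n" and M: "M \<subseteq> Kn_edges n"
    and b: "\<forall>f\<in>frees M B. \<not> f \<subseteq> touched M u v"
    and c: "\<exists>U V. u \<in> U \<and> v \<in> V \<and> U \<union> V \<subseteq> touched M u v \<and> separated M U V"
    and d: "\<forall>f\<in>frees M B. f \<inter> near2 M (k - 2) u v = {}"
    and T: "real (card (touched M u v)) \<le> \<tau> (k - 1) + 2"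
  shows "Inv2 u v M B"
proof -
  have fin: "finite (touched M u v)" using touched_lt[OF M uv] finite_subset by blast
  obtain U V where UV: "u \<in> U" "v \<in> V" "separated M U V" using c by blast
  then have disj: "near M k u \<inter> near M k v = {}" using separated_near by simp
  have "card (near2 M (k - 1) u v) \<le> card (touched M u v)"
    by (intro card_mono fin near2_touched)
  then have "2 * real (card (near2 M (k - 1) u v)) \<le> real h" using T tau_h by linarith
  then have "2 * card (near2 M (k - 1) u v) \<le> h" by linarith
  then have g: "2 * card (near2 M (k - 1) u v) \<le> b" using h by linarith
  have e: "\<forall>f\<in>frees M B. \<not> f \<subseteq> near2 M (k - 1) u v"
    using b subset_trans[OF _ near2_touched] by (intro ballI notI) metis
  have "{x, y} \<subseteq> touched M u v" if "y \<in> \<Union>M" "x \<in> near2 M (k - 1) u v" for x y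
  proof -
    have "x \<in> touched M u v" using that(2) near2_touched by (rule subsetD[rotated])
    moreover have "y \<in> touched M u v" using that(1) by (simp add: touched_def)
    ultimately show ?thesis by simp
  qed
  then have f: "\<forall>y\<in>\<Union>M - near2 M (k - 1) u v. \<forall>x\<in>near2 M (k - 1) u v. {x, y} \<notin> frees M B"
    using b by (intro ballI notI) (metis DiffD1)
  show ?thesis unfolding Inv2_def by (intro conjI uv M disj d e f g)
qed

text \<open>Breaker's answer has two halves: \<open>R1\<close> joins the ends of Maker's edge to the
  touched vertices, so that later edges are pendant, and \<open>G'\<close> closes up to
  \<open>h\<close> edges at the balls of radius \<open>j\<close>.\<close>

lemma Inv1_step:
  assumes I: "Inv1 j u v M B" and e: "e \<in> frees M B"
  shows "\<exists>R. R \<subseteq> frees (insert e M) B \<and> card R \<le> b \<and>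
     (\<forall>S. R \<subseteq> S \<longrightarrow> S \<subseteq> frees (insert e M) B \<longrightarrow> Inv (insert e M) (B \<union> S))"
proof -
  let ?M = "insert e M"
  let ?T = "touched M u v" and ?T' = "touched ?M u v"
  obtain a c where ac: "e = {a, c}" "a \<noteq> c" "a < n" "c < n" using e by (rule edgeE)
  have j: "j \<le> k - 2" and uv: "u < n" "v < n" and M: "M \<subseteq> Kn_edges n"
    and Ib: "\<forall>f\<in>frees M B. \<not> f \<subseteq> ?T"
    and Ic: "\<exists>U V. u \<in> U \<and> v \<in> V \<and> U \<union> V \<subseteq> ?T \<and> separated M U V"
    and Id: "\<forall>i<j. \<forall>f\<in>frees M B. f \<inter> near2 M i u v = {}"
    and Ie: "real (card ?T) + 2 / real h * real (card {f \<in> frees M B. f \<inter> near2 M j u v \<noteq> {}}) \<le> \<tau> (Suc j)"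
    by (insert I[unfolded Inv1_def], (elim conjE, assumption)+)
  have M': "?M \<subseteq> Kn_edges n" using M e by (auto simp: frees_def)
  have fin: "finite ?T'" using touched_lt[OF M' uv] finite_subset by blast
  have T': "?T' = ?T \<union> {a, c}" unfolding touched_def ac(1) by blast
  \<comment> \<open>Maker's edge avoids all balls of radius below \<open>j\<close>, so those of
    radius \<open>j\<close> do not change.\<close>
  have near: "near ?M i w = near M i w" if "i \<le> j" "w = u \<or> w = v" for i w
  proof (rule near_insert)
    fix m assume "m < i"
    then have "e \<inter> near2 M m u v = {}" using Id e that(1) by simp
    then show "e \<inter> near M m w = {}" using that(2) by blast
  qed
  then have near2: "near2 ?M i u v = near2 M i u v" if "i \<le> j" for i using that by simp
  have sep: "\<exists>U V. u \<in> U \<and> v \<in> V \<and> U \<union> V \<subseteq> ?T' \<and> separated ?M U V"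
  proof -
    obtain U V where UV: "u \<in> U" "v \<in> V" "U \<union> V \<subseteq> ?T" "separated M U V" using Ic by blast
    have MT: "\<Union>M \<subseteq> ?T" by (auto simp: touched_def)
    have "\<not> e \<subseteq> ?T" using Ib e by blast
    then consider "c \<notin> ?T" | "a \<notin> ?T" unfolding ac(1) by blast
    then have "\<exists>U' V'. separated ?M U' V' \<and> U \<subseteq> U' \<and> V \<subseteq> V' \<and> U' \<union> V' \<subseteq> ?T'"
    proof cases
      case 1
      from separated_step[OF UV(4,3) MT 1 ac(2)] show ?thesis unfolding T' unfolding ac(1) .
    next
      case 2
      from separated_step[OF UV(4,3) MT 2 ac(2)[symmetric]] show ?thesis
        unfolding T' unfolding ac(1) by (simp add: insert_commute)
    qed
    with UV(1,2) show ?thesis by blast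
  qed
  have tau: "\<tau> (Suc j) \<le> \<tau> (k - 1)" using j k2 by (intro tau_mono) simp
  have "0 \<le> 2 / real h * real (card {f \<in> frees M B. f \<inter> near2 M j u v \<noteq> {}})" by simp
  then have cT: "real (card ?T) \<le> \<tau> (Suc j)" using Ie by linarith
  have "card ?T' \<le> card ?T + card {a, c}" unfolding T' by (rule card_Un_le)
  then have cT': "card ?T' \<le> card ?T + 2" using ac(2) by simp
  then have cT2: "real (card ?T') \<le> \<tau> (Suc j) + 2" using cT by linarith
  then have cTh: "2 * card ?T' \<le> h" using tau tau_h by linarith
  define R1 where "R1 = frees ?M B \<inter> pairs {a, c} ?T'"
  have cR1: "card R1 \<le> h"
  proof -
    have "card R1 \<le> card (pairs {a, c} ?T')"
      unfolding R1_def using card_pairs(1) fin by (intro card_mono) auto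
    also have "\<dots> \<le> card {a, c} * card ?T'" using fin by (intro card_pairs) auto
    finally show ?thesis using cTh ac(2) by simp
  qed
  define G where "G = {f \<in> frees ?M B. f \<inter> near2 M j u v \<noteq> {}}"
  have finG: "finite G" unfolding G_def using finite_frees by simp
  have "\<exists>G'. G' \<subseteq> G \<and> card G' = min h (card G)"
    by (meson min.cobounded2 obtain_subset_with_card_n)
  then obtain G' where G': "G' \<subseteq> G" "card G' = min h (card G)" by blast
  show ?thesis
  proof (intro exI[of _ "R1 \<union> G'"] conjI allI impI)
    show "R1 \<union> G' \<subseteq> frees ?M B" using G'(1) by (auto simp: R1_def G_def)
    show "card (R1 \<union> G') \<le> b" using card_Un_le[of R1 G'] cR1 G'(2) h(1) by linarith
    fix S assume S: "R1 \<union> G' \<subseteq> S" "S \<subseteq> frees ?M B"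
    have fS: "frees ?M (B \<union> S) \<subseteq> frees M B" by (auto simp: frees_def)
    have nb: "\<forall>f\<in>frees ?M (B \<union> S). \<not> f \<subseteq> ?T'"
    proof (intro ballI notI)
      fix f assume f: "f \<in> frees ?M (B \<union> S)" "f \<subseteq> ?T'"
      have "\<not> f \<subseteq> ?T" using f(1) fS Ib by blast
      obtain x y where xy: "f = {x, y}" using f(1) by (rule edgeE)
      from \<open>\<not> f \<subseteq> ?T\<close> f(2) have "x \<in> {a, c} \<or> y \<in> {a, c}" unfolding T' xy by blast
      then have "f \<in> pairs {a, c} ?T'"
        using f(2) pairsI[of x "{a, c}" y ?T'] pairsI[of y "{a, c}" x ?T'] insert_commute[of x y "{}"]
        unfolding xy by auto
      then have "f \<in> R1" using f(1) by (auto simp: R1_def frees_def)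
      with S(1) f(1) show False by (auto simp: frees_def)
    qed
    have old: "\<forall>i<j. \<forall>f\<in>frees ?M (B \<union> S). f \<inter> near2 ?M i u v = {}"
      using Id fS near2 by (metis (no_types, lifting) less_imp_le subsetD)
    show "Inv ?M (B \<union> S)"
    proof (cases "card G \<le> h")
      \<comment> \<open>Every edge at the balls of radius \<open>j\<close> gets claimed: the next
        stage begins, or the last phase if \<open>j = k - 2\<close>.\<close>
      case True
      then have "G' = G" using G' finG card_subset_eq by (metis min.absorb2)
      then have "\<forall>f\<in>frees ?M (B \<union> S). f \<inter> near2 M j u v = {}"
        using S(1) by (auto simp: G_def frees_def)
      then have cl: "\<forall>f\<in>frees ?M (B \<union> S). f \<inter> near2 ?M j u v = {}" using near2[of j] by simp
      show ?thesis
      proof (cases "j = k - 2")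
        case True
        have "Inv2 u v ?M (B \<union> S)"
          by (rule Inv2_start[OF uv M' nb sep]) (use cl True cT2 tau in auto)
        then show ?thesis by (auto simp: Inv_def)
      next
        case False
        have old': "\<forall>i<Suc j. \<forall>f\<in>frees ?M (B \<union> S). f \<inter> near2 ?M i u v = {}"
          using old cl by (metis less_SucE)
        have "Inv1 (Suc j) u v ?M (B \<union> S)"
          by (rule stage_start[OF _ uv M' nb sep old' cT2]) (use j False in simp)
        then show ?thesis unfolding Inv_def by blast
      qed
    next
      case False
      then have cG': "card G' = h" using G'(2) by simp
      have sub: "{f \<in> frees ?M (B \<union> S). f \<inter> near2 ?M j u v \<noteq> {}} \<subseteq> G - G'"
        using S(1) near2[of j] by (auto simp: G_def frees_def)
      have "card {f \<in> frees ?M (B \<union> S). f \<inter> near2 ?M j u v \<noteq> {}} \<le> card (G - G')"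
        by (intro card_mono sub) (use finG in auto)
      also have "\<dots> = card G - h" using G'(1) finG cG' by (simp add: card_Diff_subset finite_subset)
      finally have "card {f \<in> frees ?M (B \<union> S). f \<inter> near2 ?M j u v \<noteq> {}} + h \<le> card G"
        using False by linarith
      also have "card G \<le> card {f \<in> frees M B. f \<inter> near2 M j u v \<noteq> {}}"
        unfolding G_def by (intro card_mono finite_subset[OF _ finite_frees[of M B]]) (auto simp: frees_sub)
      finally have "real (card {f \<in> frees ?M (B \<union> S). f \<inter> near2 ?M j u v \<noteq> {}}) + real h
          \<le> real (card {f \<in> frees M B. f \<inter> near2 M j u v \<noteq> {}})" by linarith
      \<comment> \<open>The two newly touched vertices are offset by \<open>h\<close> closed edges
        of value \<open>2 / h\<close> each.\<close>
      then have "2 / real h * (real (card {f \<in> frees ?M (B \<union> S). f \<inter> near2 ?M j u v \<noteq> {}}) + real h)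
          \<le> 2 / real h * real (card {f \<in> frees M B. f \<inter> near2 M j u v \<noteq> {}})"
        by (intro mult_left_mono) auto
      then have "2 / real h * real (card {f \<in> frees ?M (B \<union> S). f \<inter> near2 ?M j u v \<noteq> {}}) + 2
          \<le> 2 / real h * real (card {f \<in> frees M B. f \<inter> near2 M j u v \<noteq> {}})"
        using h(2) by (simp add: distrib_left)
      then have "real (card ?T') + 2 / real h * real (card {f \<in> frees ?M (B \<union> S). f \<inter> near2 ?M j u v \<noteq> {}})
          \<le> \<tau> (Suc j)" using Ie cT' by linarith
      then have "Inv1 j u v ?M (B \<union> S)" unfolding Inv1_def by (intro conjI j uv M' nb sep old)
      then show ?thesis unfolding Inv_def by blast
    qed
  qed
qed

text \<open>Maker's edge could make the balls of radius \<open>k\<close> meet only by lying inside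
  the balls of radius \<open>k - 1\<close> or by linking them to an outside vertex touched before.
  No such edge is free, and Breaker cuts off both ends of the new edge.\<close>

lemma Inv2_step:
  assumes I: "Inv2 u v M B" and e: "e \<in> frees M B"
  shows "\<exists>R. R \<subseteq> frees (insert e M) B \<and> card R \<le> b \<and>
     (\<forall>S. R \<subseteq> S \<longrightarrow> S \<subseteq> frees (insert e M) B \<longrightarrow> Inv (insert e M) (B \<union> S))"
proof -
  let ?M = "insert e M"
  obtain a c where ac: "e = {a, c}" "a \<noteq> c" "a < n" "c < n" using e by (rule edgeE)
  define P where "P = near M (k - 1) u"
  define R where "R = near M (k - 1) v"
  have uv: "u < n" "v < n" and M: "M \<subseteq> Kn_edges n"
    and Ic: "near M k u \<inter> near M k v = {}"
    and Id: "\<forall>f\<in>frees M B. f \<inter> near2 M (k - 2) u v = {}"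
    and Ie: "\<forall>f\<in>frees M B. \<not> f \<subseteq> P \<union> R"
    and If: "\<forall>y\<in>\<Union>M - (P \<union> R). \<forall>x\<in>P \<union> R. {x, y} \<notin> frees M B"
    and Ig: "2 * card (P \<union> R) \<le> b"
    unfolding P_def R_def by (insert I[unfolded Inv2_def], (elim conjE, assumption)+)
  have M': "?M \<subseteq> Kn_edges n" using M e by (auto simp: frees_def)
  have nonear: "e \<inter> near M i w = {}" if "i \<le> k - 2" "w = u \<or> w = v" for i w
    using Id e near_mono[OF that(1), of M w] that(2) by blast
  have near: "near ?M i w = near M i w" if "i \<le> k - 1" "w = u \<or> w = v" for i w
    by (rule near_insert) (use nonear that in auto)
  have PR': "near ?M (k - 1) u = P" "near ?M (k - 1) v = R" "near2 ?M (k - 2) u v = near2 M (k - 2) u v"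
    using near by (auto simp: P_def R_def)
  have finPR: "finite (P \<union> R)"
    using finite_subset[OF subset_trans[OF near2_touched touched_lt[OF M uv]], of "k - 1"] by (simp add: P_def R_def)
  have k: "k = Suc (k - 1)" using k2 by simp
  have nk: "near L k w = near L (k - 1) w \<union> {x. \<exists>y\<in>near L (k - 1) w. {y, x} \<in> L}" for L w
    using near_Suc[of L "k - 1" w] k by simp
  define Q where "Q = frees ?M B \<inter> pairs {a, c} (P \<union> R)"
  have cQ: "card Q \<le> b"
  proof -
    have "card Q \<le> card (pairs {a, c} (P \<union> R))"
      unfolding Q_def using card_pairs(1) finPR by (intro card_mono) auto
    also have "\<dots> \<le> card {a, c} * card (P \<union> R)" using finPR by (intro card_pairs) auto
    finally show ?thesis using Ig ac(2) by simp
  qed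
  have disj: "near ?M k u \<inter> near ?M k v = {}"
  proof (rule ccontr)
    assume "near ?M k u \<inter> near ?M k v \<noteq> {}"
    then obtain x where "x \<in> near ?M k u" "x \<in> near ?M k v" by blast
    then have xu: "x \<in> P \<or> (\<exists>y\<in>P. {y, x} \<in> ?M)" and xv: "x \<in> R \<or> (\<exists>y\<in>R. {y, x} \<in> ?M)"
      by (simp_all only: nk PR' Un_iff mem_Collect_eq)
    have "\<not> (x \<in> near M k u \<and> x \<in> near M k v)" using Ic by blast
    then have old: "\<not> ((x \<in> P \<or> (\<exists>y\<in>P. {y, x} \<in> M)) \<and> (x \<in> R \<or> (\<exists>y\<in>R. {y, x} \<in> M)))"
      by (simp only: nk P_def R_def Un_iff mem_Collect_eq) simp
    have "P \<subseteq> near M k u" "R \<subseteq> near M k v" unfolding P_def R_def by (rule near_mono, simp)+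
    then have PRd: "P \<inter> R = {}" using Ic by blast
    have inside: False if "y \<in> P \<union> R" "z \<in> P \<union> R" "{y, z} = e" for y z
    proof -
      have "e \<subseteq> P \<union> R" unfolding that(3)[symmetric] using that(1,2) by simp
      with Ie e show False by simp
    qed
    show False
    proof (cases "x \<in> P")
      case True
      then have "x \<notin> R" using PRd by blast
      with xv obtain z where z: "z \<in> R" "{z, x} \<in> ?M" by blast
      with True old have "{z, x} \<notin> M" by blast
      then show False using inside[of z x] z True by simp
    next
      case xP: False
      with xu obtain y where y: "y \<in> P" "{y, x} \<in> ?M" by blast
      show False
      proof (cases "x \<in> R")
        case True
        with y old have "{y, x} \<notin> M" by blast
        then show False using inside[of y x] y True by simp
      next
        case xR: False
        with xv obtain z where z: "z \<in> R" "{z, x} \<in> ?M" by blast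
        have "z \<noteq> y" using y(1) z(1) PRd by blast
        \<comment> \<open>A common vertex outside both balls needs two different edges, only one of
          which is new; the other shows that it was touched before.\<close>
        then have ne: "{y, x} \<noteq> {z, x}" by (simp add: doubleton_eq_iff)
        have "\<not> ({y, x} \<in> M \<and> {z, x} \<in> M)" using old y(1) z(1) by blast
        with y(2) z(2) ne have "{y, x} = e \<and> {z, x} \<in> M \<or> {z, x} = e \<and> {y, x} \<in> M"
          unfolding insert_iff by argo
        then show False
        proof (elim disjE conjE)
          assume *: "{y, x} = e" "{z, x} \<in> M"
          then have "x \<in> \<Union>M - (P \<union> R)" using xP xR by blast
          then have "{y, x} \<notin> frees M B" using If y(1) by simp
          with * e show False by simp
        next
          assume *: "{z, x} = e" "{y, x} \<in> M"
          then have "x \<in> \<Union>M - (P \<union> R)" using xP xR by blast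
          then have "{z, x} \<notin> frees M B" using If z(1) by simp
          with * e show False by simp
        qed
      qed
    qed
  qed
  show ?thesis
  proof (intro exI[of _ Q] conjI allI impI cQ)
    show "Q \<subseteq> frees ?M B" by (auto simp: Q_def)
    fix S assume S: "Q \<subseteq> S" "S \<subseteq> frees ?M B"
    have fS: "frees ?M (B \<union> S) \<subseteq> frees M B" by (auto simp: frees_def)
    have f: "\<forall>y\<in>\<Union>?M - (P \<union> R). \<forall>x\<in>P \<union> R. {x, y} \<notin> frees ?M (B \<union> S)"
    proof (intro ballI notI)
      fix x y assume y: "y \<in> \<Union>?M - (P \<union> R)" and x: "x \<in> P \<union> R" and fr: "{x, y} \<in> frees ?M (B \<union> S)"
      show False
      proof (cases "y \<in> \<Union>M")
        case True
        with If x y fr fS show False by blast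
      next
        case False
        then have "y \<in> {a, c}" using y ac(1) by blast
        then have "{y, x} \<in> pairs {a, c} (P \<union> R)" using x by (intro pairsI)
        then have "{x, y} \<in> Q" using fr insert_commute[of x y "{}"] by (simp add: Q_def frees_def)
        with S(1) fr show False by (auto simp: frees_def)
      qed
    qed
    have d: "\<forall>f\<in>frees ?M (B \<union> S). f \<inter> near2 M (k - 2) u v = {}"
      and ee: "\<forall>f\<in>frees ?M (B \<union> S). \<not> f \<subseteq> P \<union> R" using Id Ie fS by blast+
    have "Inv2 u v ?M (B \<union> S)" unfolding Inv2_def PR' by (intro conjI uv M' disj d ee f Ig)
    then show "Inv ?M (B \<union> S)" unfolding Inv_def by blast
  qed
qed

text \<open>\<open>u\<close> and \<open>v\<close> are chosen off Maker's first edge. At most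
  \<open>2 * 4\<close> edges join them to the touched vertices.\<close>

lemma Inv0_step:
  assumes e: "e \<in> frees {} {}"
  shows "\<exists>R. R \<subseteq> frees {e} {} \<and> card R \<le> b \<and> (\<forall>S. R \<subseteq> S \<longrightarrow> S \<subseteq> frees {e} {} \<longrightarrow> Inv {e} S)"
proof -
  obtain a c where ac: "e = {a, c}" "a \<noteq> c" "a < n" "c < n" using e by (rule edgeE)
  have "card ({..<n} - {a, c}) = n - 2" using ac by (simp add: card_Diff_subset)
  then have "2 \<le> card ({..<n} - {a, c})" using n4 by simp
  then obtain Z where Z: "Z \<subseteq> {..<n} - {a, c}" "card Z = 2" by (meson obtain_subset_with_card_n)
  then obtain u v where uv: "u \<noteq> v" "Z = {u, v}" by (meson card_2_iff)
  have uvn: "u < n" "v < n" "u \<noteq> a" "u \<noteq> c" "v \<noteq> a" "v \<noteq> c" using Z(1) uv(2) by auto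
  have T: "touched {e} u v = {u, v} \<union> {a, c}" by (auto simp: touched_def ac)
  have cT: "card (touched {e} u v) \<le> 4"
    unfolding T using card_Un_le[of "{u, v}" "{a, c}"] uv(1) ac(2) by simp
  define R where "R = frees {e} {} \<inter> pairs {u, v} (touched {e} u v)"
  have cR: "card R \<le> b"
  proof -
    have "card R \<le> card (pairs {u, v} (touched {e} u v))"
      unfolding R_def using card_pairs(1) by (intro card_mono) (auto simp: T)
    also have "\<dots> \<le> card {u, v} * card (touched {e} u v)" by (intro card_pairs) (auto simp: T)
    also have "\<dots> \<le> 8" using cT uv(1) by simp
    also have "8 \<le> b"
    proof -
      have "8 \<le> real h" using tau_h tau_ge[of "k - 1"] by linarith
      then show ?thesis using h(1) by linarith
    qed
    finally show ?thesis .
  qed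
  have M: "{e} \<subseteq> Kn_edges n" using e by (auto simp: frees_def)
  have ue: "u \<notin> e" "v \<notin> e" using uvn unfolding ac(1) by simp_all
  have sep: "\<exists>U V. u \<in> U \<and> v \<in> V \<and> U \<union> V \<subseteq> touched {e} u v \<and> separated {e} U V"
    by (rule exI[of _ "{u}"], rule exI[of _ "{v}"]) (use uv ue in \<open>simp add: separated_def T\<close>)
  show ?thesis
  proof (intro exI[of _ R] conjI allI impI cR)
    show "R \<subseteq> frees {e} {}" by (auto simp: R_def)
    fix S assume S: "R \<subseteq> S" "S \<subseteq> frees {e} {}"
    have nb: "\<forall>f\<in>frees {e} S. \<not> f \<subseteq> touched {e} u v"
    proof (intro ballI notI)
      fix f assume f: "f \<in> frees {e} S" "f \<subseteq> touched {e} u v"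
      obtain x y where xy: "f = {x, y}" "x \<noteq> y" using f(1) by (rule edgeE)
      have "f \<noteq> {a, c}" using f(1) ac(1) by (auto simp: frees_def)
      then have "x \<in> {u, v} \<or> y \<in> {u, v}" using f(2) xy unfolding T by blast
      then have "f \<in> pairs {u, v} (touched {e} u v)"
        using f(2) pairsI[of x "{u, v}" y "touched {e} u v"] pairsI[of y "{u, v}" x "touched {e} u v"]
          insert_commute[of x y "{}"] unfolding xy by auto
      then have "f \<in> R" using f(1) by (auto simp: R_def frees_def)
      with S(1) f(1) show False by (auto simp: frees_def)
    qed
    have "Inv1 0 u v {e} S"
      by (rule stage_start[OF _ uvn(1,2) M nb sep]) (use cT tau0 in auto)
    then show "Inv {e} S" unfolding Inv_def by blast
  qed
qed

text \<open>A walk of length at most \<open>2 * k\<close> has a vertex within distance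
  \<open>k\<close> of both ends, but the balls of radius \<open>k\<close> around \<open>u\<close>
  and \<open>v\<close> are disjoint.\<close>

lemma Inv_final:
  assumes I: "Inv M B" and fin: "Kn_edges n - M - B = {}" and W: "W \<in> diam_winning_sets s n"
  shows "\<not> W \<subseteq> M"
proof
  assume WM: "W \<subseteq> M"
  have fr: "frees M B = {}" using fin by (simp add: frees_def)
  have conn: "conn M (2 * k) u v" if "u < n" "v < n" for u v
  proof (cases "u = v")
    case False
    with that W have "conn W s u v" by (auto simp: diam_winning_sets_def path_within_iff_conn)
    then show ?thesis using conn_mono WM s by blast
  qed simp
  have meet: "near M k u \<inter> near M k v \<noteq> {}" if uv: "u < n" "v < n" for u v
  proof -
    have "conn M (k + k) u v" using conn[OF uv] by (simp add: mult_2)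
    then obtain w where "conn M k u w" "conn M k w v" using conn_split by blast
    then have "w \<in> near M k u \<inter> near M k v" using conn_sym by (auto simp: near_def)
    then show ?thesis by blast
  qed
  from I consider "M = {}" "B = {}" | j u v where "Inv1 j u v M B" | u v where "Inv2 u v M B"
    unfolding Inv_def by blast
  then show False
  proof cases
    case 1
    have "{0, 1} \<in> Kn_edges n" using n4 by (auto simp: edge_in_Kn)
    with fin 1 show False by blast
  next
    case 2
    have uv: "u < n" "v < n"
      and sep: "\<exists>U V. u \<in> U \<and> v \<in> V \<and> U \<union> V \<subseteq> touched M u v \<and> separated M U V"
      by (insert 2[unfolded Inv1_def], (elim conjE, assumption)+)
    from sep obtain U V where "u \<in> U" "v \<in> V" "separated M U V" by (elim exE conjE)
    note UV = uv this
    with meet[OF UV(1,2)] separated_near[OF UV(5,3,4)] show False by blast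
  next
    case 3
    have "u < n" "v < n" "near M k u \<inter> near M k v = {}"
      by (insert 3[unfolded Inv2_def], (elim conjE, assumption)+)
    with meet show False by simp
  qed
qed

theorem breaker_wins_diameter: "breaker_wins (Kn_edges n) (diam_winning_sets s n) b"
proof (rule breaker_wins_by_invariant[of _ Inv])
  fix M B e assume "Inv M B" and e: "e \<in> Kn_edges n - M - B"
  then consider "M = {}" "B = {}" | j u v where "Inv1 j u v M B" | u v where "Inv2 u v M B"
    unfolding Inv_def by blast
  then show "\<exists>R. R \<subseteq> Kn_edges n - insert e M - B \<and> card R \<le> b \<and>
    (\<forall>S. R \<subseteq> S \<longrightarrow> S \<subseteq> Kn_edges n - insert e M - B \<longrightarrow> Inv (insert e M) (B \<union> S))"
  proof cases
    case 1
    with e Inv0_step[of e] show ?thesis by (simp add: frees_def)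
  next
    case 2
    from Inv1_step[OF 2] e show ?thesis unfolding frees_def by blast
  next
    case 3
    from Inv2_step[OF 3] e show ?thesis unfolding frees_def by blast
  qed
next
  show "Inv {} {}" by (simp add: Inv_def)
qed (use Inv_final finite_Kn_edges in auto)

end

section \<open>The order of the threshold\<close>

lemma ev_ln_le_powr:
  fixes a c K :: real
  assumes "a > 0" "c > 0" "K > 0"
  shows "\<forall>\<^sub>F n in sequentially. 4 * ln (real n ^ 2 * K) + 8 \<le> c * real n powr a"
  using assms by real_asymp

lemma ev_powr_le_self:
  fixes a C :: real
  assumes "a < 1" "a > 0" "C > 0"
  shows "\<forall>\<^sub>F n in sequentially. C * real n powr a + 1 \<le> real n"
  using assms by real_asymp

lemma ev_const_le_powr:
  fixes a c K :: real
  assumes "a > 0" "c > 0"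
  shows "\<forall>\<^sub>F n in sequentially. K \<le> c * real n powr a"
  using assms by real_asymp


text \<open>The real number \<open>y = n powr (1 / k)\<close> carries the asymptotics: \<open>n = y ^ k\<close>,
  and the claimed order of the threshold is \<open>y ^ (k - 1)\<close>.\<close>

lemma root_powers:
  assumes k: "k \<ge> (2::nat)" and n: "n > (0::nat)"
  defines "y \<equiv> real n powr (1 / k)"
  shows "y > 0" "y ^ k = n" "y ^ (k - 1) = real n powr (1 - 1 / k)"
proof -
  show y: "y > 0" using n by (simp add: y_def)
  have pow: "y ^ m = real n powr (real m / k)" for m
    using n by (simp add: y_def powr_realpow[symmetric] powr_powr)
  show "y ^ k = n" using k n by (simp add: pow)
  show "y ^ (k - 1) = real n powr (1 - 1 / k)"
    using k by (simp add: pow of_nat_diff diff_divide_distrib)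
qed

text \<open>With \<open>D\<close> and \<open>b\<close> the integer parts of \<open>y\<close> and
  \<open>c * y ^ (k - 1)\<close>, the product \<open>b * D\<close> is at most \<open>c * n\<close>,
  while \<open>lam\<close> is only logarithmic in \<open>n\<close>.\<close>

lemma maker_wins_eventually:
  fixes k s :: nat
  assumes k: "k \<ge> 2" and s: "2 * k - 1 \<le> s"
  defines "c \<equiv> 1 / (134217728 * real k * 2 ^ k)"
  shows "\<forall>\<^sub>F n in sequentially. \<forall>b. real b \<le> c * real n powr (1 - 1 / k) \<longrightarrow>
    maker_wins (Kn_edges n) (diam_winning_sets s n) b"
proof -
  have c0: "c > 0" using k by (simp add: c_def)
  have a: "1 / real k > 0" "1 - 1 / real k > 0" using k by (auto simp: field_simps)
  have ev: "\<forall>\<^sub>F n in sequentially. n > 0 \<and>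
      4 * ln (real n ^ 2 * real (k + 1)) + 8 \<le> 1 * real n powr (1 / k) \<and>
      4 * ln (real n ^ 2 * real (k + 1)) + 8 \<le> (1 / 2 ^ k) * real n powr (1 - 1 / k) \<and>
      1 \<le> c * real n powr (1 - 1 / k)"
    by (intro eventually_conj eventually_gt_at_top ev_ln_le_powr ev_const_le_powr a c0) (use k in auto)
  show ?thesis
  proof (rule eventually_mono[OF ev], intro allI impI)
    fix n b' assume A: "n > 0 \<and>
      4 * ln (real n ^ 2 * real (k + 1)) + 8 \<le> 1 * real n powr (1 / k) \<and>
      4 * ln (real n ^ 2 * real (k + 1)) + 8 \<le> (1 / 2 ^ k) * real n powr (1 - 1 / k) \<and>
      1 \<le> c * real n powr (1 - 1 / k)"
    assume b': "real b' \<le> c * real n powr (1 - 1 / k)"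
    define y where "y = real n powr (1 / k)"
    define lam where "lam = ln (real n ^ 2 * real (k + 1))"
    define D where "D = nat \<lfloor>y\<rfloor>"
    define b where "b = nat \<lfloor>c * y ^ (k - 1)\<rfloor>"
    have n: "n > 0" using A by blast
    note y = root_powers[OF k n, folded y_def]
    have A1: "4 * lam + 8 \<le> y" and A2: "4 * lam + 8 \<le> y ^ (k - 1) / 2 ^ k" and A3: "1 \<le> c * y ^ (k - 1)"
      using A y(3) by (simp_all add: lam_def y_def)
    have "1 * 1 \<le> real n ^ 2 * real (k + 1)" using n by (intro mult_mono) auto
    then have lam0: "lam \<ge> 0" unfolding lam_def by (intro ln_ge_zero) simp
    have Dy: "real D \<le> y" "y - 1 < real D" using y(1) by (simp_all add: D_def)
    have bc: "real b \<le> c * y ^ (k - 1)" using A3 by (simp add: b_def)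
    have b1: "b \<ge> 1" using A3 unfolding b_def by linarith
    have yk: "y ^ (k - 1) * y = n" using y(2) k by (simp add: power_eq_if mult.commute)
    have "real D ^ k \<le> y ^ k" using Dy by (intro power_mono) auto
    then have Dk: "D ^ k \<le> n" using y(2) by (metis of_nat_le_iff of_nat_power)
    have "real b * real D \<le> c * y ^ (k - 1) * y"
      using bc Dy(1) y(1) c0 by (intro mult_mono) auto
    then have bD1: "real b * real D \<le> c * n" using yk by (simp add: mult.assoc)
    have "c * (134217728 * real k) = 1 / 2 ^ k" using k by (simp add: c_def)
    then have ck: "c * (134217728 * real k) \<le> 1" by simp
    have "134217728 * real k * (real b * real D) \<le> 134217728 * real k * (c * n)"
      using bD1 by (intro mult_left_mono) auto
    also have "\<dots> = c * (134217728 * real k) * n" by simp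
    also have "\<dots> \<le> 1 * real n" using ck by (intro mult_right_mono) auto
    finally have "real (134217728 * k * b * D) \<le> real n" by (simp add: mult_ac)
    then have bD: "134217728 * k * b * D \<le> n" unfolding of_nat_le_iff .
    \<comment> \<open>Rounding costs at most a factor 2 in \<open>D\<close>, hence the factor
      \<open>2 ^ k\<close> in \<open>c\<close>.\<close>
    have y2: "y / 2 \<le> real D" using A1 lam0 Dy(2) by linarith
    have "(y / 2) ^ (k - 1) \<le> real D ^ (k - 1)" using y2 y(1) by (intro power_mono) auto
    moreover have "(y / 2) ^ (k - 1) = 2 * (y ^ (k - 1) / 2 ^ k)"
      using k by (cases k) (auto simp: power_divide)
    ultimately have D1: "2 * (y ^ (k - 1) / 2 ^ k) \<le> real D ^ (k - 1)" by simp
    have "8192 * c \<le> 1 / 2 ^ k" using k by (simp add: c_def field_simps)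
    then have "8192 * c * y ^ (k - 1) \<le> 1 / 2 ^ k * y ^ (k - 1)" using y(1) by (intro mult_right_mono) auto
    then have "8192 * real b \<le> y ^ (k - 1) / 2 ^ k" using bc by simp
    then have bDk: "8192 * b + 4 * lam + 8 \<le> real (D ^ (k - 1))" using A2 D1 by simp
    have lamD: "lam \<le> real D" using A1 lam0 Dy(2) by linarith
    have "D \<ge> 1" using A1 lam0 Dy(2) by linarith
    interpret maker_game n k D b "1024 * b" "n div 256" lam
      using k b1 \<open>D \<ge> 1\<close> lamD lam0 Dk bD bDk n by unfold_locales (auto simp: lam_def)
    have "b' \<le> b" using b' unfolding b_def y(3) by linarith
    with s show "maker_wins (Kn_edges n) (diam_winning_sets s n) b'"
      by (rule maker_wins_diameter)
  qed
qed

text \<open>With \<open>h\<close> about \<open>60 * y ^ (k - 1)\<close> the ratio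
  \<open>n / h\<close> is at most \<open>y / 60\<close>, so \<open>\<tau>\<close> grows by less than
  a factor \<open>y\<close> per stage and \<open>\<tau> (k - 1)\<close> is at most
  \<open>4 * y ^ (k - 1)\<close>.\<close>

lemma breaker_wins_eventually:
  fixes k s :: nat
  assumes k: "k \<ge> 2" and s: "s \<le> 2 * k"
  shows "\<forall>\<^sub>F n in sequentially. \<exists>b. real b \<le> 180 * real n powr (1 - 1 / k) \<and>
    breaker_wins (Kn_edges n) (diam_winning_sets s n) b"
proof -
  have a: "1 - 1 / real k > 0" "1 - 1 / real k < 1" using k by (auto simp: field_simps)
  have ev: "\<forall>\<^sub>F n in sequentially. n \<ge> 4 \<and> 60 * real n powr (1 - 1 / k) + 1 \<le> real n \<and>
      1 \<le> 1 * real n powr (1 - 1 / k)"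
    by (intro eventually_conj eventually_ge_at_top ev_powr_le_self ev_const_le_powr a) auto
  show ?thesis
  proof (rule eventually_mono[OF ev])
    fix n assume A: "n \<ge> 4 \<and> 60 * real n powr (1 - 1 / k) + 1 \<le> real n \<and>
      1 \<le> 1 * real n powr (1 - 1 / k)"
    define y where "y = real n powr (1 / k)"
    define h where "h = nat \<lceil>60 * y ^ (k - 1)\<rceil>"
    define x where "x = real n / real h"
    define \<tau> where "\<tau> = rec_nat 4 (\<lambda>_ t. (t + 2) * (1 + 2 * real n / real h))"
    have n: "n > 0" using A by simp
    note y = root_powers[OF k n, folded y_def]
    have A2: "60 * y ^ (k - 1) + 1 \<le> real n" and A3: "1 \<le> y ^ (k - 1)" using A y(3) by simp_all
    have hb: "60 * y ^ (k - 1) \<le> real h" "real h < 60 * y ^ (k - 1) + 1"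
      using A3 unfolding h_def by linarith+
    have h0: "real h > 0" using hb(1) A3 by linarith
    have x1: "x \<ge> 1" using hb(2) A2 h0 by (simp add: x_def)
    have yk: "y ^ (k - 1) * y = n" using y(2) k by (simp add: power_eq_if mult.commute)
    have "x \<le> real n / (60 * y ^ (k - 1))"
      unfolding x_def using hb(1) A3 by (intro divide_left_mono) auto
    also have "\<dots> = y / 60" using y(1) by (simp add: yk[symmetric])
    finally have xy: "5 * x \<le> y / 12" by simp
    have tau: "4 \<le> \<tau> i \<and> \<tau> i \<le> 4 * (5 * x) ^ i" for i
    proof (induction i)
      case (Suc i)
      have S: "\<tau> (Suc i) = (\<tau> i + 2) * (1 + 2 * x)" by (simp add: \<tau>_def x_def)
      \<comment> \<open>\<open>\<tau> i \<ge> 4\<close> absorbs the summand 2 and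
        \<open>x \<ge> 1\<close> the summand 1.\<close>
      have "\<tau> (Suc i) \<le> (3 / 2 * \<tau> i) * (3 * x)"
        unfolding S using Suc x1 by (intro mult_mono) auto
      also have "\<dots> = 9 / 2 * x * \<tau> i" by simp
      also have "\<dots> \<le> (5 * x) * \<tau> i" using Suc x1 by (intro mult_right_mono) auto
      also have "\<dots> \<le> (5 * x) * (4 * (5 * x) ^ i)" using Suc x1 by (intro mult_left_mono) auto
      finally have "\<tau> (Suc i) \<le> 4 * (5 * x) ^ Suc i" by simp
      moreover have "4 * 1 \<le> (\<tau> i + 2) * (1 + 2 * x)" using Suc x1 by (intro mult_mono) auto
      ultimately show ?case using S by simp
    qed (simp add: \<tau>_def)
    have "(5 * x) ^ (k - 1) \<le> y ^ (k - 1)" using xy x1 y(1) by (intro power_mono) auto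
    with tau[of "k - 1"] have "2 * \<tau> (k - 1) + 4 \<le> 12 * y ^ (k - 1)" using A3 by linarith
    then have tau_h: "2 * \<tau> (k - 1) + 4 \<le> real h" using hb(1) A3 by linarith
    interpret breaker_game n k h "2 * h" s \<tau>
      using k s A h0 tau_h by unfold_locales (auto simp: \<tau>_def)
    have "real (2 * h) \<le> 180 * y ^ (k - 1)" using hb(2) A3 by simp
    then show "\<exists>b. real b \<le> 180 * real n powr (1 - 1 / k) \<and>
        breaker_wins (Kn_edges n) (diam_winning_sets s n) b"
      using breaker_wins_diameter y(3) by metis
  qed
qed

theorem theorem1p10:
  fixes s :: nat
  assumes "s \<ge> 3"
  shows "\<exists>c1 c2 :: real. c1 > 0 \<and> c2 > 0 \<and>
    (\<forall>\<^sub>F n in sequentially.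
       c1 * real n powr (1 - 1 / real_of_int \<lceil>real s / 2\<rceil>) \<le> real (diameter_threshold s n) \<and>
       real (diameter_threshold s n) \<le> c2 * real n powr (1 - 1 / real_of_int \<lceil>real s / 2\<rceil>))"
proof -
  define k where "k = (s + 1) div 2"
  have k: "k \<ge> 2" "2 * k - 1 \<le> s" "s \<le> 2 * k" using assms by (auto simp: k_def)
  have ceil: "real_of_int \<lceil>real s / 2\<rceil> = real k"
  proof -
    have "\<lceil>real s / 2\<rceil> = int k" using k by (intro ceiling_unique) auto
    then show ?thesis by simp
  qed
  define c where "c = 1 / (134217728 * real k * 2 ^ k)"
  have "c > 0" using k by (simp add: c_def)
  moreover have "\<forall>\<^sub>F n in sequentially.
      c * real n powr (1 - 1 / k) \<le> real (diameter_threshold s n) \<and>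
      real (diameter_threshold s n) \<le> 180 * real n powr (1 - 1 / k)"
    using maker_wins_eventually[OF k(1,2), folded c_def] breaker_wins_eventually[OF k(1,3)]
  proof eventually_elim
    case (elim n)
    then obtain b where b: "real b \<le> 180 * real n powr (1 - 1 / k)"
      "breaker_wins (Kn_edges n) (diam_winning_sets s n) b" by blast
    have le: "diameter_threshold s n \<le> b"
      unfolding diameter_threshold_def threshold_bias_def using b(2) by (rule Least_le)
    \<comment> \<open>Breaker wins at the least such bias, whereas Maker wins at every bias up to
      the lower bound; hence the threshold lies above it.\<close>
    have "breaker_wins (Kn_edges n) (diam_winning_sets s n) (diameter_threshold s n)"
      unfolding diameter_threshold_def threshold_bias_def using b(2) by (rule LeastI)
    then have "\<not> real (diameter_threshold s n) \<le> c * real n powr (1 - 1 / k)"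
      using elim(1) unfolding breaker_wins_def by blast
    with le b(1) show ?case by simp
  qed
  ultimately show ?thesis unfolding ceil by (intro exI[of _ c] exI[of _ 180]) auto
qed

end
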